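(* Let $q\geq 3$ be an integer, let $G\in\mathcal{A}(q)$ with maximum degree $t\geq q+2$, and let $f$ and $g$ be two different proper $t$-colorings of $G$. Assume that the subgraph $G(f,g,t)$ contains a component $C$ which is a cycle whose edges receive at least $q+2$ distinct colors under $f$ and all of whose vertices have degree $t$ in $G$, and that there is a path $P$ in $G$, $t$-alternating with respect to $f$, satisfying: (1) $C$ and $P$ have exactly one common vertex, which is the terminus of $P$; (2) the origin of $P$ has degree less than $t$ in $G$; (3) if $P$ has odd length, then the color $t$ is missing under $f$ at the origin of $P$. Then there is a proper $t$-coloring $\overline f$ of $G$ such that $\overline f$ is $(q+1)$-equivalent to $f$, every edge of $M(\overline f,t)\triangle M(f,t)$ belongs to $C$, and $|M(\overline f,t)\cap M(g,t)|>|M(f,t)\cap M(g,t)|$.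
   Context: Graphs are finite and simple. A $t$-coloring of $G$ is a map $f:E(G)\to\{1,\dots,t\}$; it is proper if adjacent edges get distinct colors. $M(f,j)$ is the set of edges of color $j$ under $f$. A color is missing at a vertex $v$ under $f$ if no edge incident with $v$ has that color. A path or cycle is $t$-alternating (with respect to $f$) if, of any two consecutive edges on it, one has color $t$. For an integer $q\geq 2$, $\mathcal{A}(q)$ is the set of graphs $G$ such that every subgraph $H$ of $G$ with $\Delta(H)\leq q$ has a proper $q$-edge-coloring. $G(f,g,t)$ is the subgraph of $G$ formed by the edge set $M(f,t)\triangle M(g,t)$ together with its endpoints. Two $t$-colorings differ by at most $n$ color classes if the number of colors $j$ with $M(f,j)\neq M(g,j)$ is at most $n$. Two proper $t$-colorings $f,h$ are $n$-equivalent if there is a sequence $f_0=f,f_1,\dots,f_k=h$ ($k\geq 1$) of proper $t$-colorings of $G$ with $f_i$ differing from $f_{i-1}$ by at most $n$ color classes for each $i$. *)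

theory Defs
  imports Main "HOL-Library.FuncSet"
begin

text \<open>A graph is a pair of a vertex set and a set of two-element edges.\<close>

type_synonym 'a graph = "'a set \<times> 'a set set"

abbreviation verts :: "'a graph \<Rightarrow> 'a set" where
  "verts G \<equiv> fst G"

abbreviation edges :: "'a graph \<Rightarrow> 'a set set" where
  "edges G \<equiv> snd G"

definition simple_graph :: "'a graph \<Rightarrow> bool" where
  "simple_graph G \<longleftrightarrow> finite (verts G) \<and> (\<forall>e \<in> edges G. e \<subseteq> verts G \<and> card e = 2)"

definition subgraph :: "'a graph \<Rightarrow> 'a graph \<Rightarrow> bool" where
  "subgraph H G \<longleftrightarrow> simple_graph H \<and> verts H \<subseteq> verts G \<and> edges H \<subseteq> edges G"

definition degree :: "'a graph \<Rightarrow> 'a \<Rightarrow> nat" where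
  "degree G v = card {e \<in> edges G. v \<in> e}"

text \<open>The inserted \<open>0\<close> only matters for the graph without vertices.\<close>

definition max_degree :: "'a graph \<Rightarrow> nat" where
  "max_degree G = Max (insert 0 (degree G ` verts G))"

text \<open>A path is given by its list of vertices, from the origin \<open>hd p\<close> to the terminus \<open>last p\<close>;
  its length is the number of its edges.\<close>

definition is_path :: "'a graph \<Rightarrow> 'a list \<Rightarrow> bool" where
  "is_path G p \<longleftrightarrow> p \<noteq> [] \<and> distinct p \<and> set p \<subseteq> verts G \<and>
     (\<forall>i. Suc i < length p \<longrightarrow> {p ! i, p ! Suc i} \<in> edges G)"

definition path_edges :: "'a list \<Rightarrow> 'a set list" where
  "path_edges p = map (\<lambda>i. {p ! i, p ! Suc i}) [0..<length p - 1]"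

definition path_length :: "'a list \<Rightarrow> nat" where
  "path_length p = length (path_edges p)"

definition connected_graph :: "'a graph \<Rightarrow> bool" where
  "connected_graph G \<longleftrightarrow> verts G \<noteq> {} \<and>
     (\<forall>u \<in> verts G. \<forall>v \<in> verts G. \<exists>p. is_path G p \<and> hd p = u \<and> last p = v)"

definition is_component :: "'a graph \<Rightarrow> 'a graph \<Rightarrow> bool" where
  "is_component C G \<longleftrightarrow> subgraph C G \<and> connected_graph C \<and>
     (\<forall>D. subgraph D G \<and> connected_graph D \<and> subgraph C D \<longrightarrow> D = C)"

definition is_cycle :: "'a graph \<Rightarrow> bool" where
  "is_cycle C \<longleftrightarrow> (\<exists>vs. length vs \<ge> 3 \<and> distinct vs \<and> verts C = set vs \<and>
     edges C = {{vs ! i, vs ! (Suc i mod length vs)} | i. i < length vs})"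

text \<open>Colorings are functions with domain exactly \<open>edges G\<close> (extensional functions), so that
  equality of colorings is equality of functions.\<close>

definition coloring :: "'a graph \<Rightarrow> nat \<Rightarrow> ('a set \<Rightarrow> nat) \<Rightarrow> bool" where
  "coloring G t f \<longleftrightarrow> f \<in> edges G \<rightarrow>\<^sub>E {1..t}"

definition proper_coloring :: "'a graph \<Rightarrow> nat \<Rightarrow> ('a set \<Rightarrow> nat) \<Rightarrow> bool" where
  "proper_coloring G t f \<longleftrightarrow> coloring G t f \<and>
     (\<forall>e \<in> edges G. \<forall>e' \<in> edges G. e \<noteq> e' \<and> e \<inter> e' \<noteq> {} \<longrightarrow> f e \<noteq> f e')"

definition color_class :: "'a graph \<Rightarrow> ('a set \<Rightarrow> nat) \<Rightarrow> nat \<Rightarrow> 'a set set" where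
  "color_class G f j = {e \<in> edges G. f e = j}"

definition missing_at :: "'a graph \<Rightarrow> ('a set \<Rightarrow> nat) \<Rightarrow> nat \<Rightarrow> 'a \<Rightarrow> bool" where
  "missing_at G f c v \<longleftrightarrow> \<not> (\<exists>e \<in> edges G. v \<in> e \<and> f e = c)"

definition alternating_path :: "('a set \<Rightarrow> nat) \<Rightarrow> nat \<Rightarrow> 'a list \<Rightarrow> bool" where
  "alternating_path f c p \<longleftrightarrow> (\<forall>i. Suc i < length (path_edges p) \<longrightarrow>
     f (path_edges p ! i) = c \<or> f (path_edges p ! Suc i) = c)"

definition class_A :: "nat \<Rightarrow> 'a graph set" where
  "class_A q = {G. simple_graph G \<and>
     (\<forall>H. subgraph H G \<and> max_degree H \<le> q \<longrightarrow> (\<exists>f. proper_coloring H q f))}"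

definition diff_subgraph ::
  "'a graph \<Rightarrow> ('a set \<Rightarrow> nat) \<Rightarrow> ('a set \<Rightarrow> nat) \<Rightarrow> nat \<Rightarrow> 'a graph" where
  "diff_subgraph G f g c =
     (\<Union> (sym_diff (color_class G f c) (color_class G g c)),
      sym_diff (color_class G f c) (color_class G g c))"

definition differ_by_at_most ::
  "'a graph \<Rightarrow> nat \<Rightarrow> nat \<Rightarrow> ('a set \<Rightarrow> nat) \<Rightarrow> ('a set \<Rightarrow> nat) \<Rightarrow> bool" where
  "differ_by_at_most G t n f g \<longleftrightarrow>
     card {j \<in> {1..t}. color_class G f j \<noteq> color_class G g j} \<le> n"

definition n_equivalent ::
  "'a graph \<Rightarrow> nat \<Rightarrow> nat \<Rightarrow> ('a set \<Rightarrow> nat) \<Rightarrow> ('a set \<Rightarrow> nat) \<Rightarrow> bool" where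
  "n_equivalent G t n f h \<longleftrightarrow> (\<exists>k \<ge> 1. \<exists>F :: nat \<Rightarrow> 'a set \<Rightarrow> nat. F 0 = f \<and> F k = h \<and>
     (\<forall>i \<le> k. proper_coloring G t (F i)) \<and>
     (\<forall>i \<in> {1..k}. differ_by_at_most G t n (F (i - 1)) (F i)))"

end

theory Submission
  imports Defs
begin

text \<open>
  Membership in \<open>class_A q\<close> lets us recolor any edge set of maximum degree at most \<open>q\<close>: so within
  \<open>q + 1\<close> color classes the class of \<open>t\<close> may be replaced by any matching whose removal leaves maximum
  degree at most \<open>q\<close>. The class of \<open>t\<close> cannot be flipped along \<open>C\<close> piece by piece, since all vertices
  of \<open>C\<close> have degree \<open>t\<close>; it can be in a coloring of \<open>G\<close> minus one edge \<open>yz\<close> with \<open>t\<close> missing at the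
  ``hole'' \<open>y\<close>. If some color \<open>d \<noteq> t\<close> is missing at \<open>z\<close>, then for every set \<open>X\<close> of \<open>q\<close> colors
  containing \<open>t\<close> and \<open>d\<close> the classes in \<open>X\<close> together with \<open>yz\<close> have maximum degree at most \<open>q\<close>, so
  recoloring them gives a proper coloring of all of \<open>G\<close>. Moving the hole over two further edges of an
  alternating walk, the first of color \<open>c\<close>, only affects the \<open>q + 1\<close> colors of \<open>X \<union> {c}\<close>, so the
  associated colorings of \<open>G\<close> are \<open>q + 1\<close>-equivalent. The hole starts near the origin of \<open>P\<close>, where the
  small degree provides the spare color, runs along \<open>P\<close>, around \<open>C\<close>, and back along \<open>P\<close>. The two
  passes over \<open>P\<close> cancel and exactly \<open>C\<close> is flipped.
\<close>

section \<open>Proper colorings of edge sets and recoloring within a set of colors\<close>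

definition proper_on :: "'a set set \<Rightarrow> ('a set \<Rightarrow> nat) \<Rightarrow> bool" where
  "proper_on A \<phi> \<longleftrightarrow> (\<forall>a \<in> A. \<forall>b \<in> A. a \<noteq> b \<and> a \<inter> b \<noteq> {} \<longrightarrow> \<phi> a \<noteq> \<phi> b)"

text \<open>The two edge sets may differ because an edge can be uncolored. Comparing whole classes
  also forces every edge lying in only one of the sets to have a color in \<open>S\<close>.\<close>

definition agree_off ::
  "nat set \<Rightarrow> 'a set set \<Rightarrow> ('a set \<Rightarrow> nat) \<Rightarrow> 'a set set \<Rightarrow> ('a set \<Rightarrow> nat) \<Rightarrow> bool" where
  "agree_off S A \<phi> B \<chi> \<longleftrightarrow> (\<forall>j. j \<notin> S \<longrightarrow> {a \<in> A. \<phi> a = j} = {a \<in> B. \<chi> a = j})"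

lemma exists_not_mem_if_card_less:
  assumes "finite B" "card B < card A"
  shows "\<exists>c \<in> A. c \<notin> B"
  using assms card_mono[of B A] by (meson not_le subsetI)

text \<open>The cancellation in \<open>flip_cycle\<close>: \<open>A\<close> holds the path edges
  that are traversed twice, while \<open>B\<close> and \<open>e\<close> make up the cycle.\<close>

lemma sym_diff_replace:
  assumes "A \<inter> B = {}" "e \<notin> A \<union> B"
  shows "sym_diff (sym_diff M (A \<union> B)) (insert e A) = sym_diff M (insert e B)"
  using assms by auto

lemma agree_off_trans:
  "agree_off S A \<phi> B \<chi> \<Longrightarrow> agree_off S B \<chi> D \<psi> \<Longrightarrow> agree_off S A \<phi> D \<psi>"
  unfolding agree_off_def by simp

lemma agree_off_sym: "agree_off S A \<phi> B \<chi> \<Longrightarrow> agree_off S B \<chi> A \<phi>"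
  unfolding agree_off_def by simp

lemma agree_off_mono: "agree_off S A \<phi> B \<chi> \<Longrightarrow> S \<subseteq> T \<Longrightarrow> agree_off T A \<phi> B \<chi>"
  unfolding agree_off_def by blast

lemma agree_off_iff:
  "agree_off S A \<phi> B \<chi> \<Longrightarrow> {a \<in> A. \<phi> a \<notin> S} = {a \<in> B. \<chi> a \<notin> S}"
  unfolding agree_off_def set_eq_iff mem_Collect_eq by metis

lemma agree_off_range:
  assumes "agree_off S A \<phi> B \<chi>" "\<phi> ` A \<subseteq> T" "S \<subseteq> T"
  shows "\<chi> ` B \<subseteq> T"
proof
  fix j assume "j \<in> \<chi> ` B"
  then obtain a where a: "a \<in> B" "\<chi> a = j" by blast
  show "j \<in> T"
  proof (cases "j \<in> S")
    case False
    then have "a \<in> {a \<in> A. \<phi> a = j}" using assms(1) a unfolding agree_off_def by simp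
    then show ?thesis using assms(2) by blast
  qed (use assms(3) in blast)
qed

text \<open>Edges at \<open>v\<close> meet pairwise, so \<open>\<phi>\<close> injects them into
  \<open>Y\<close>. The degree bounds below come from this count.\<close>

lemma proper_on_card_le:
  assumes "proper_on A \<phi>" "finite Y"
  shows "card {a \<in> A. v \<in> a \<and> \<phi> a \<in> Y} \<le> card Y"
proof (rule card_inj_on_le)
  show "inj_on \<phi> {a \<in> A. v \<in> a \<and> \<phi> a \<in> Y}"
  proof (rule inj_onI)
    fix a b assume "a \<in> {a \<in> A. v \<in> a \<and> \<phi> a \<in> Y}" "b \<in> {a \<in> A. v \<in> a \<and> \<phi> a \<in> Y}" "\<phi> a = \<phi> b"
    then show "a = b" using assms(1) unfolding proper_on_def by blast
  qed
qed (use assms(2) in auto)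

lemma proper_coloring_iff:
  "proper_coloring G t f \<longleftrightarrow>
     proper_on (edges G) f \<and> f ` edges G \<subseteq> {1..t} \<and> f \<in> extensional (edges G)"
  unfolding proper_coloring_def proper_on_def coloring_def PiE_def Pi_iff image_subset_iff Int_iff
  by argo

lemma simple_graph_finite_edges: "simple_graph G \<Longrightarrow> finite (edges G)"
  unfolding simple_graph_def by (rule finite_subset[of _ "Pow (verts G)"]) auto

text \<open>\<open>class_A\<close> is applied to the graph with all vertices of \<open>G\<close> and
  edge set \<open>R\<close>; a bijection carries its colors \<open>{1..q}\<close> to
  \<open>X\<close>.\<close>

lemma class_A_colorable:
  assumes G: "G \<in> class_A q" and R: "R \<subseteq> edges G"
    and deg: "\<And>v. card {a \<in> R. v \<in> a} \<le> q" and X: "card X = q" "finite X"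
  shows "\<exists>\<psi>. proper_on R \<psi> \<and> \<psi> ` R \<subseteq> X"
proof -
  have sg: "simple_graph G" using G unfolding class_A_def by blast
  have "subgraph (verts G, R) G"
    using sg R unfolding subgraph_def simple_graph_def fst_conv snd_conv by blast
  moreover have "max_degree (verts G, R) \<le> q"
    using sg deg unfolding max_degree_def degree_def simple_graph_def by auto
  ultimately obtain \<psi> where "proper_coloring (verts G, R) q \<psi>"
    using G unfolding class_A_def by blast
  then have \<psi>: "proper_on R \<psi>" "\<psi> ` R \<subseteq> {1..q}" unfolding proper_coloring_iff by auto
  obtain b where "bij_betw b {1..q} X"
    using X finite_same_card_bij[of "{1..q}" X] by auto
  then have b: "inj_on b {1..q}" "b ` {1..q} = X" by (auto simp: bij_betw_def)
  have "proper_on R (b \<circ> \<psi>)"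
    unfolding proper_on_def
  proof (intro ballI impI)
    fix a c assume ac: "a \<in> R" "c \<in> R" "a \<noteq> c \<and> a \<inter> c \<noteq> {}"
    then have "\<psi> a \<noteq> \<psi> c" using \<psi>(1) unfolding proper_on_def by simp
    moreover have "\<psi> a \<in> {1..q}" "\<psi> c \<in> {1..q}" using \<psi>(2) ac by blast+
    ultimately show "(b \<circ> \<psi>) a \<noteq> (b \<circ> \<psi>) c" using b(1) by (simp add: inj_on_eq_iff)
  qed
  then show ?thesis using \<psi>(2) b(2) by (intro exI[of _ "b \<circ> \<psi>"]) auto
qed

text \<open>No conflict arises between the two parts: \<open>\<psi>\<close> uses only colors of
  \<open>S\<close>, and the edges outside \<open>R\<close> keep colors outside
  \<open>S\<close>.\<close>

lemma recolor:
  assumes "proper_on A \<phi>" "{a \<in> A. \<phi> a \<notin> S} \<subseteq> B"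
    and R: "R = B - {a \<in> A. \<phi> a \<notin> S}" and "proper_on R \<psi>" "\<psi> ` R \<subseteq> S"
  shows "\<exists>\<chi>. proper_on B \<chi> \<and> agree_off S A \<phi> B \<chi> \<and> (\<forall>a \<in> R. \<chi> a = \<psi> a)"
proof -
  let ?\<chi> = "\<lambda>a. if a \<in> R then \<psi> a else \<phi> a"
  have RS: "\<psi> a \<in> S" if "a \<in> R" for a using that assms(5) by blast
  have nR: "a \<in> A \<and> \<phi> a \<notin> S" if "a \<in> B" "a \<notin> R" for a using that R by blast
  have "proper_on B ?\<chi>"
    unfolding proper_on_def
  proof (intro ballI impI)
    fix a b assume ab: "a \<in> B" "b \<in> B" "a \<noteq> b \<and> a \<inter> b \<noteq> {}"
    show "?\<chi> a \<noteq> ?\<chi> b"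
    proof (cases "a \<in> R \<longleftrightarrow> b \<in> R")
      case True
      then show ?thesis using assms(1,4) nR ab unfolding proper_on_def by simp
    next
      case False
      then show ?thesis using RS nR ab(1,2) by (metis (full_types))
    qed
  qed
  moreover have "agree_off S A \<phi> B ?\<chi>"
    unfolding agree_off_def
  proof (intro allI impI equalityI subsetI)
    fix j a assume j: "j \<notin> S" "a \<in> {a \<in> A. \<phi> a = j}"
    then have "a \<in> B - R" using assms(2) R by blast
    then show "a \<in> {a \<in> B. ?\<chi> a = j}" using j by simp
  next
    fix j a assume j: "j \<notin> S" "a \<in> {a \<in> B. ?\<chi> a = j}"
    then have "a \<notin> R" using RS by auto
    then show "a \<in> {a \<in> A. \<phi> a = j}" using j nR by simp
  qed
  ultimately show ?thesis by (intro exI[of _ ?\<chi>]) simp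
qed

text \<open>The edges free to be recolored are those with a color in \<open>S\<close> and the
  uncolored ones. The matching \<open>M\<close> among them receives \<open>t\<close>; the others
  have degree at most \<open>q\<close> and are colored with the \<open>q\<close> colors of
  \<open>S - {t}\<close>.\<close>

lemma recolor_with_matching:
  assumes G: "G \<in> class_A q" and A: "proper_on A \<phi>" "{a \<in> A. \<phi> a \<notin> S} \<subseteq> B" "B \<subseteq> edges G"
    and M: "M \<subseteq> B" "\<And>a. a \<in> M \<Longrightarrow> a \<in> A \<Longrightarrow> \<phi> a \<in> S"
    and dis: "pairwise disjnt M"
    and S: "card S = q + 1" "t \<in> S"
    and deg: "\<And>v. card {a \<in> B. v \<in> a \<and> (a \<in> A \<longrightarrow> \<phi> a \<in> S) \<and> a \<notin> M} \<le> q"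
  shows "\<exists>\<chi>. proper_on B \<chi> \<and> agree_off S A \<phi> B \<chi> \<and> {a \<in> B. \<chi> a = t} = M"
proof -
  let ?R = "B - {a \<in> A. \<phi> a \<notin> S}"
  have "{a \<in> ?R - M. v \<in> a} = {a \<in> B. v \<in> a \<and> (a \<in> A \<longrightarrow> \<phi> a \<in> S) \<and> a \<notin> M}" for v
    by blast
  then have "card {a \<in> ?R - M. v \<in> a} \<le> q" for v using deg[of v] by simp
  moreover have "card (S - {t}) = q" "finite (S - {t})"
    using S by (simp_all add: card_ge_0_finite)
  ultimately obtain \<psi> where \<psi>: "proper_on (?R - M) \<psi>" "\<psi> ` (?R - M) \<subseteq> S - {t}"
    using class_A_colorable[OF G, of "?R - M" "S - {t}"] A(3) by blast
  let ?\<psi> = "\<lambda>a. if a \<in> M then t else \<psi> a"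
  have \<psi>': "\<psi> a \<in> S \<and> \<psi> a \<noteq> t" if "a \<in> ?R" "a \<notin> M" for a using \<psi>(2) that by blast
  have "proper_on ?R ?\<psi>"
    unfolding proper_on_def
  proof (intro ballI impI)
    fix a b assume ab: "a \<in> ?R" "b \<in> ?R" "a \<noteq> b \<and> a \<inter> b \<noteq> {}"
    then have "\<not> (a \<in> M \<and> b \<in> M)" using dis unfolding pairwise_def disjnt_def by blast
    then consider "a \<notin> M" "b \<notin> M" | "a \<in> M" "b \<notin> M" | "a \<notin> M" "b \<in> M" by blast
    then show "?\<psi> a \<noteq> ?\<psi> b"
    proof cases
      case 1
      then have "a \<in> ?R - M" "b \<in> ?R - M" using ab by blast+
      then have "\<psi> a \<noteq> \<psi> b" using \<psi>(1) ab(3) unfolding proper_on_def by blast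
      then show ?thesis using 1 by simp
    next
      case 2
      then show ?thesis using \<psi>'[OF ab(2)] by simp
    next
      case 3
      then show ?thesis using \<psi>'[OF ab(1)] by simp
    qed
  qed
  moreover have "?\<psi> ` ?R \<subseteq> S" using \<psi>' S(2) by auto
  ultimately obtain \<chi> where \<chi>: "proper_on B \<chi>" "agree_off S A \<phi> B \<chi>" "\<forall>a \<in> ?R. \<chi> a = ?\<psi> a"
    using recolor[OF A(1,2) refl, of ?\<psi>] by blast
  have "{a \<in> B. \<chi> a = t} = M"
  proof (intro equalityI subsetI)
    fix a assume a: "a \<in> {a \<in> B. \<chi> a = t}"
    have "{a \<in> A. \<phi> a \<notin> S} = {a \<in> B. \<chi> a \<notin> S}" using agree_off_iff[OF \<chi>(2)] .
    then have "a \<in> ?R" using a S(2) by blast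
    then show "a \<in> M" using \<chi>(3) \<psi>' a by force
  next
    fix a assume a: "a \<in> M"
    then have "a \<in> ?R" using M by blast
    then show "a \<in> {a \<in> B. \<chi> a = t}" using \<chi>(3) a by auto
  qed
  then show ?thesis using \<chi> by blast
qed

section \<open>Chains of colorings that differ in few classes\<close>

lemma n_equivalent_refl: "proper_coloring G t f \<Longrightarrow> n_equivalent G t n f f"
  unfolding n_equivalent_def differ_by_at_most_def
  by (intro exI[of _ 1] conjI exI[of _ "\<lambda>_. f"]) auto

text \<open>The chain grows at its front because the newest coloring is always the first argument
  and \<open>f\<close> stays the last.\<close>

lemma n_equivalent_step:
  assumes "n_equivalent G t n h f" "proper_coloring G t h'" "differ_by_at_most G t n h' h"
  shows "n_equivalent G t n h' f"
proof -
  obtain k :: nat and F where k: "k \<ge> 1" "F 0 = h" "F k = f" "\<forall>i \<le> k. proper_coloring G t (F i)"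
    "\<forall>i \<in> {1..k}. differ_by_at_most G t n (F (i - 1)) (F i)"
    using assms(1) unfolding n_equivalent_def by blast
  define F' where "F' = case_nat h' F"
  have "\<forall>i \<le> Suc k. proper_coloring G t (F' i)"
    using k(4) assms(2) by (auto simp: F'_def split: nat.split)
  moreover have "differ_by_at_most G t n (F' (i - 1)) (F' i)" if "i \<in> {1..Suc k}" for i
  proof (cases "i = 1")
    case True
    then show ?thesis using assms(3) k(2) by (simp add: F'_def)
  next
    case False
    define j where "j = i - 2"
    have "i = Suc (Suc j)" using that False by (auto simp: j_def)
    then show ?thesis using that k(5)[rule_format, of "Suc j"] by (simp add: F'_def)
  qed
  ultimately show ?thesis unfolding n_equivalent_def
    by (intro exI[of _ "Suc k"] conjI exI[of _ F']) (auto simp: F'_def k)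
qed

lemma agree_off_differ_by_at_most:
  assumes "agree_off S (edges G) h (edges G) h'" "finite S" "card S \<le> n"
  shows "differ_by_at_most G t n h' h"
proof -
  have "{j \<in> {1..t}. color_class G h' j \<noteq> color_class G h j} \<subseteq> S"
    using assms(1) unfolding agree_off_def color_class_def by auto
  then show ?thesis unfolding differ_by_at_most_def
    by (meson card_mono assms(2,3) order_trans)
qed

text \<open>A recoloring within at most \<open>n\<close> colors is a single link of the chain.
  Restricting to the edge set makes it extensional, as a coloring of \<open>G\<close> must
  be.\<close>

lemma agree_off_n_equivalent:
  assumes "n_equivalent G t n h f" "agree_off S (edges G) h (edges G) \<chi>" "h ` edges G \<subseteq> {1..t}"
    and "finite S" "card S \<le> n" "S \<subseteq> {1..t}" "proper_on (edges G) \<chi>"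
  shows "proper_coloring G t (restrict \<chi> (edges G)) \<and> n_equivalent G t n (restrict \<chi> (edges G)) f"
proof -
  have "\<chi> ` edges G \<subseteq> {1..t}" using agree_off_range[OF assms(2,3,6)] .
  then have p: "proper_coloring G t (restrict \<chi> (edges G))"
    using assms(7) unfolding proper_coloring_iff proper_on_def by auto
  have "agree_off S (edges G) h (edges G) (restrict \<chi> (edges G))"
    using assms(2) unfolding agree_off_def by (auto cong: conj_cong)
  then show ?thesis
    using p agree_off_differ_by_at_most[of S G h "restrict \<chi> (edges G)" n t] assms(1,4,5) n_equivalent_step by blast
qed

text \<open>\<open>\<phi>\<close> colors all edges but those of \<open>D\<close>, its class of color \<open>t\<close> is \<open>M\<close>, and \<open>h\<close> is an associated
  coloring of all of \<open>G\<close>. The degree condition is what remains of the requirement that the end of the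
  uncolored edge other than \<open>y\<close> misses a color of \<open>X\<close> different from \<open>t\<close>; in this form it also covers
  \<open>D = {}\<close>.\<close>

definition hole_state ::
  "'a graph \<Rightarrow> nat \<Rightarrow> nat \<Rightarrow> ('a set \<Rightarrow> nat) \<Rightarrow> 'a set set \<Rightarrow> 'a set set \<Rightarrow> 'a \<Rightarrow> bool" where
  "hole_state G q t f D M y \<longleftrightarrow> D \<subseteq> edges G \<and> card D \<le> 1 \<and> y \<notin> \<Union>M \<and>
     (\<exists>\<phi> h X. proper_on (edges G - D) \<phi> \<and> {a \<in> edges G - D. \<phi> a = t} = M \<and>
        X \<subseteq> {1..t} \<and> card X = q \<and> t \<in> X \<and>
        (\<forall>v. v \<noteq> y \<longrightarrow> card {a \<in> edges G. v \<in> a \<and> (a \<in> D \<or> \<phi> a \<in> X - {t})} \<le> q - 1) \<and>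
        proper_coloring G t h \<and> agree_off X (edges G) h (edges G - D) \<phi> \<and>
        n_equivalent G t (q + 1) h f)"


lemma hole_stateI:
  assumes "D \<subseteq> edges G" "card D \<le> 1" "y \<notin> \<Union>M"
    and "proper_on (edges G - D) \<phi>" "{a \<in> edges G - D. \<phi> a = t} = M"
    and "X \<subseteq> {1..t}" "card X = q" "t \<in> X"
    and "\<And>v. v \<noteq> y \<Longrightarrow> card {a \<in> edges G. v \<in> a \<and> (a \<in> D \<or> \<phi> a \<in> X - {t})} \<le> q - 1"
    and "proper_coloring G t h" "agree_off X (edges G) h (edges G - D) \<phi>"
    and "n_equivalent G t (q + 1) h f"
  shows "hole_state G q t f D M y"
  unfolding hole_state_def by (intro conjI exI allI impI) (fact assms)+

definition walk_edge :: "(nat \<Rightarrow> 'a) \<Rightarrow> nat \<Rightarrow> 'a set" where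
  "walk_edge v i = {v i, v (Suc i)}"

text \<open>Equal edges traversed in opposite directions would require both \<open>i = Suc j\<close>
  and \<open>Suc i = j\<close>.\<close>

lemma walk_edge_eq_iff:
  assumes "inj_on v {..n}" "i < n" "j < n"
  shows "walk_edge v i = walk_edge v j \<longleftrightarrow> i = j"
proof
  assume "walk_edge v i = walk_edge v j"
  then consider "v i = v j" | "v i = v (Suc j)" "v (Suc i) = v j"
    unfolding walk_edge_def doubleton_eq_iff by blast
  then show "i = j"
  proof cases
    case 1
    then show ?thesis using inj_onD[OF assms(1)] assms(2,3) by simp
  next
    case 2
    then have "i = Suc j" "Suc i = j" using inj_onD[OF assms(1)] assms(2,3) by simp_all
    then show ?thesis by simp
  qed
qed simp

section \<open>Opening, moving and closing the hole\<close>

locale edge_colored_graph =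
  fixes G :: "'a graph" and q t :: nat and f :: "'a set \<Rightarrow> nat"
  assumes G: "G \<in> class_A q" and q: "2 \<le> q" and q_less_t: "q < t"
    and f: "proper_coloring G t f"
begin

abbreviation "E \<equiv> edges G"

lemma simple: "simple_graph G" using G unfolding class_A_def by blast

lemma finite_E: "finite E" using simple by (rule simple_graph_finite_edges)

lemma card_edge: "e \<in> E \<Longrightarrow> card e = 2" using simple unfolding simple_graph_def by blast

lemma edge_neq: "{x, y} \<in> E \<Longrightarrow> x \<noteq> y" using card_edge by fastforce

lemma color_class_disjoint:
  assumes "proper_on A \<phi>" "{a \<in> A. \<phi> a = j} = M"
  shows "pairwise disjnt M"
  using assms unfolding proper_on_def pairwise_def disjnt_def by blast

lemma exists_colors_containing:
  assumes "c \<in> {1..t}" "c \<noteq> t"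
  obtains X where "X \<subseteq> {1..t}" "card X = q" "t \<in> X" "c \<in> X"
proof -
  have "card {c, t} \<le> q" "{c, t} \<subseteq> {1..t}" "q \<le> card {1..t}" using assms q q_less_t by auto
  then obtain X where "{c, t} \<subseteq> X" "X \<subseteq> {1..t}" "card X = q"
    using exists_subset_between[of "{c, t}" q "{1..t}"] by blast
  then show ?thesis using that by blast
qed

text \<open>Giving \<open>e1\<close> the color \<open>t\<close> frees its old color at the hole,
  which makes room there for the edge of \<open>D\<close>. With \<open>D'\<close> a single edge the
  hole moves on; with \<open>D' = {}\<close> it is closed.\<close>

lemma hole_advance:
  assumes st: "hole_state G q t f D M y" and e1: "e1 \<in> E - D" "y \<in> e1"
    and D': "D' \<subseteq> M" and M': "M' = insert e1 (M - D')"
    and dis: "pairwise disjnt M'"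
  obtains \<chi> S h where "S \<subseteq> {1..t}" "card S = q + 1" "t \<in> S" "proper_coloring G t h"
    "n_equivalent G t (q + 1) h f" "proper_on (E - D') \<chi>" "agree_off S E h (E - D') \<chi>"
    "{a \<in> E - D'. \<chi> a = t} = M'"
proof -
  obtain \<phi> h X where D: "D \<subseteq> E" "card D \<le> 1" "y \<notin> \<Union>M"
    and \<phi>: "proper_on (E - D) \<phi>" "{a \<in> E - D. \<phi> a = t} = M"
    and X: "X \<subseteq> {1..t}" "card X = q" "t \<in> X"
    and deg: "\<forall>v. v \<noteq> y \<longrightarrow> card {a \<in> E. v \<in> a \<and> (a \<in> D \<or> \<phi> a \<in> X - {t})} \<le> q - 1"
    and h: "proper_coloring G t h" "agree_off X E h (E - D) \<phi>" "n_equivalent G t (q + 1) h f"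
    using st unfolding hole_state_def by (elim conjE exE) (rule that; assumption)
  define c where "c = \<phi> e1"
  have "\<phi> ` (E - D) \<subseteq> {1..t}"
    using agree_off_range[OF h(2) _ X(1)] h(1) unfolding proper_coloring_iff by blast
  then have c: "c \<in> {1..t}" unfolding c_def using e1(1) by blast
  have "e1 \<notin> M" using D(3) e1(2) by blast
  then have ct: "c \<noteq> t" using \<phi>(2) e1(1) unfolding c_def by blast
  have finX: "finite X" using X(1) finite_subset by blast
  have "\<exists>s \<in> {1..t}. s \<notin> X" using exists_not_mem_if_card_less[OF finX] X(2) q_less_t by simp
  \<comment> \<open>\<open>s\<close> is \<open>c\<close> itself if \<open>c\<close> is not in
    \<open>X\<close>, and an arbitrary further color otherwise; either way \<open>insert s X\<close>
    has \<open>q + 1\<close> elements and contains \<open>c\<close>.\<close>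
  then obtain s where s: "s \<in> {1..t} - X" "c \<in> insert s X" using c by blast
  define S where "S = insert s X"
  have S: "S \<subseteq> {1..t}" "card S = q + 1" "t \<in> S" "X \<subseteq> S" "c \<in> S" "finite S"
    unfolding S_def using s X finX by auto
  have card_S: "card (S - {t, c}) = q - 1"
    using S(2,3,5,6) ct by (simp add: card_Diff_subset)
  have finD: "finite D" using D(1) finite_E finite_subset by blast
  have "card {a \<in> E - D'. v \<in> a \<and> (a \<in> E - D \<longrightarrow> \<phi> a \<in> S) \<and> a \<notin> M'} \<le> q" for v
  proof -
    let ?Z = "{a \<in> E - D'. v \<in> a \<and> (a \<in> E - D \<longrightarrow> \<phi> a \<in> S) \<and> a \<notin> M'}"
    have Z: "a \<in> E \<and> v \<in> a \<and> a \<noteq> e1 \<and> (a \<notin> D \<longrightarrow> \<phi> a \<in> S - {t})" if "a \<in> ?Z" for a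
    proof -
      have "a \<notin> M" using that M' by blast
      then have "a \<notin> D \<longrightarrow> \<phi> a \<noteq> t" using \<phi>(2) that by blast
      then show ?thesis using that M' by blast
    qed
    show ?thesis
    proof (cases "v = y")
      \<comment> \<open>At the hole \<open>t\<close> is missing and \<open>c\<close> occurs only on
        \<open>e1\<close>, so besides the edge of \<open>D\<close> at most \<open>q - 1\<close>
        edges remain.\<close>
      case True
      let ?W = "{a \<in> E - D. v \<in> a \<and> \<phi> a \<in> S - {t, c}}"
      have "?Z \<subseteq> D \<union> ?W"
      proof
        fix a assume a: "a \<in> ?Z"
        have "\<phi> a \<noteq> c" if "a \<notin> D"
        proof -
          have "a \<in> E - D" "a \<noteq> e1" "a \<inter> e1 \<noteq> {}" using Z[OF a] that True e1(2) by blast+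
          then show ?thesis using \<phi>(1) e1(1) unfolding proper_on_def c_def by simp
        qed
        then show "a \<in> D \<union> ?W" using Z[OF a] by blast
      qed
      then have "card ?Z \<le> card (D \<union> ?W)" using finD finite_E by (intro card_mono) auto
      also have "\<dots> \<le> card D + card ?W" by (rule card_Un_le)
      also have "\<dots> \<le> 1 + (q - 1)"
        using D(2) proper_on_card_le[OF \<phi>(1), of "S - {t, c}" v] S(6) card_S by simp
      finally show ?thesis using q by simp
    next
      \<comment> \<open>Away from the hole the degree condition of the state gives
        \<open>q - 1\<close>, and \<open>s\<close> contributes at most one more edge.\<close>
      case False
      let ?U = "{a \<in> E. v \<in> a \<and> (a \<in> D \<or> \<phi> a \<in> X - {t})}"
      let ?W = "{a \<in> E - D. v \<in> a \<and> \<phi> a \<in> {s}}"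
      have "?Z \<subseteq> ?U \<union> ?W"
      proof
        fix a assume a: "a \<in> ?Z"
        show "a \<in> ?U \<union> ?W" using Z[OF a] unfolding S_def by blast
      qed
      then have "card ?Z \<le> card (?U \<union> ?W)" using finite_E by (intro card_mono) auto
      also have "\<dots> \<le> card ?U + card ?W" by (rule card_Un_le)
      also have "\<dots> \<le> (q - 1) + 1"
        using deg[rule_format, OF False] proper_on_card_le[OF \<phi>(1), of "{s}" v] by simp
      finally show ?thesis using q by simp
    qed
  qed
  moreover have "{a \<in> E - D. \<phi> a \<notin> S} \<subseteq> E - D'" using D' \<phi>(2) S(3) by blast
  moreover have "M' \<subseteq> E - D'" using M' \<phi>(2) e1 D' \<open>e1 \<notin> M\<close> by blast
  moreover have "\<phi> a \<in> S" if "a \<in> M'" "a \<in> E - D" for a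
    using that M' \<phi>(2) S(3,5) unfolding c_def by blast
  ultimately have "\<exists>\<chi>. proper_on (E - D') \<chi> \<and> agree_off S (E - D) \<phi> (E - D') \<chi> \<and>
      {a \<in> E - D'. \<chi> a = t} = M'"
    by (intro recolor_with_matching[OF G \<phi>(1) _ _ _ _ dis S(2,3)]) (assumption | rule Diff_subset)+
  then obtain \<chi> where \<chi>: "proper_on (E - D') \<chi>" "agree_off S (E - D) \<phi> (E - D') \<chi>"
    "{a \<in> E - D'. \<chi> a = t} = M'"
    by blast
  have "agree_off S E h (E - D') \<chi>"
    using agree_off_trans[OF agree_off_mono[OF h(2) S(4)] \<chi>(2)] .
  then show ?thesis using that[OF S(1-3) h(1,3) \<chi>(1) _ \<chi>(3)] by simp
qed

text \<open>The edge \<open>{y, z}\<close> receives \<open>t\<close> and \<open>{z, y'}\<close>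
  becomes uncolored. The main point is to find a new \<open>X\<close> with a color other than
  \<open>t\<close> missing at \<open>z\<close>, and with it a new associated coloring of all of
  \<open>G\<close>.\<close>

lemma hole_step:
  assumes st: "hole_state G q t f D M y" and e1: "{y, z} \<in> E - D" and e2: "{z, y'} \<in> M"
  shows "hole_state G q t f {{z, y'}} (insert {y, z} M - {{z, y'}}) y'"
proof -
  define e1 where "e1 = {y, z}"
  define e2 where "e2 = {z, y'}"
  define M' where "M' = insert e1 (M - {e2})"
  have yM: "y \<notin> \<Union>M" using st unfolding hole_state_def by blast
  obtain \<phi> where \<phi>: "proper_on (E - D) \<phi>" "{a \<in> E - D. \<phi> a = t} = M"
    using st unfolding hole_state_def by blast
  have e2E: "e2 \<in> E" "e2 \<in> M" and e1E: "e1 \<in> E - D" "e1 \<in> E"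
    using \<phi>(2) e2 assms(2) unfolding e1_def e2_def by blast+
  have Mdis: "a \<inter> b = {}" if "a \<in> M" "b \<in> M" "a \<noteq> b" for a b
    using color_class_disjoint[OF \<phi>] that unfolding pairwise_def disjnt_def by simp
  have neq: "y \<noteq> z" "z \<noteq> y'" "y \<noteq> y'" "e1 \<noteq> e2"
    using edge_neq e1E e2E yM unfolding e1_def e2_def by blast+
  have e1dis: "e1 \<inter> a = {}" if "a \<in> M - {e2}" for a
    using that yM Mdis[of e2 a] e2E unfolding e1_def e2_def by blast
  have M'dis: "pairwise disjnt M'"
    unfolding M'_def pairwise_insert disjnt_def
    using color_class_disjoint[OF \<phi>] e1dis
    by (auto simp: pairwise_def disjnt_def)
  have y'M': "y' \<notin> \<Union>M'"
    using Mdis[of e2] e2E neq unfolding M'_def e1_def e2_def by blast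
  have ye1: "y \<in> e1" and De2: "{e2} \<subseteq> M" using e2E unfolding e1_def by auto
  obtain \<chi> S h where S: "S \<subseteq> {1..t}" "card S = q + 1" "t \<in> S"
    and h: "proper_coloring G t h" "n_equivalent G t (q + 1) h f"
    and \<chi>: "proper_on (E - {e2}) \<chi>" "agree_off S E h (E - {e2}) \<chi>" "{a \<in> E - {e2}. \<chi> a = t} = M'"
    by (rule hole_advance[OF st e1E(1) ye1 De2 M'_def M'dis])
  have finS: "finite S" using S(1) finite_subset by blast
  have hE: "proper_on E h" "h ` E \<subseteq> {1..t}" using h(1) unfolding proper_coloring_iff by auto
  have \<chi>S: "{a \<in> E - {e2}. \<chi> a \<notin> S} = {a \<in> E. h a \<notin> S}" using agree_off_iff[OF \<chi>(2)] by simp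
  \<comment> \<open>By agreement, the edges other than \<open>e2\<close> with a color in
    \<open>S\<close> are the same under \<open>\<chi>\<close> and \<open>h\<close>. Under
    \<open>h\<close> the edge \<open>e2\<close> also has a color in \<open>S\<close>, so at most
    \<open>q\<close> of those edges meet \<open>z\<close>, too few for the \<open>q + 1\<close>
    colors of \<open>S\<close>.\<close>
  have "\<exists>d \<in> S. \<forall>a \<in> E - {e2}. z \<in> a \<longrightarrow> \<chi> a \<noteq> d"
  proof (rule ccontr)
    assume "\<not> ?thesis"
    then have all: "\<exists>a \<in> E - {e2}. z \<in> a \<and> \<chi> a = d" if "d \<in> S" for d using that by simp
    let ?W = "{a \<in> E. z \<in> a \<and> h a \<in> S}"
    have finW: "finite ?W" using finite_E by simp
    have e2W: "e2 \<in> ?W" using \<chi>S e2E unfolding e2_def by blast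
    have "S \<subseteq> \<chi> ` (?W - {e2})"
    proof
      fix d assume "d \<in> S"
      then obtain a where a: "a \<in> E - {e2}" "z \<in> a" "\<chi> a = d" using all by blast
      then have "a \<in> ?W - {e2}" using \<chi>S \<open>d \<in> S\<close> by blast
      then show "d \<in> \<chi> ` (?W - {e2})" using a(3) by blast
    qed
    then have "card S \<le> card (?W - {e2})"
      using finW by (meson card_image_le card_mono finite_Diff finite_imageI order_trans)
    also have "\<dots> < card ?W" using finW e2W by (rule card_Diff1_less)
    also have "\<dots> \<le> card S" using proper_on_card_le[OF hE(1) finS] .
    finally show False by simp
  qed
  then obtain d where d: "d \<in> S" "\<forall>a \<in> E - {e2}. z \<in> a \<longrightarrow> \<chi> a \<noteq> d" by blast
  have "\<chi> e1 = t" using \<chi>(3) unfolding M'_def by blast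
  then have dt: "d \<noteq> t" using d(2) e1E neq unfolding e1_def by blast
  \<comment> \<open>One color is dropped to return to \<open>q\<close> colors while keeping
    \<open>t\<close> and \<open>d\<close>; it exists since \<open>S\<close> has at least three
    elements.\<close>
  have "\<exists>s \<in> S. s \<notin> {t, d}" using S(2) q dt by (intro exists_not_mem_if_card_less) simp_all
  then obtain s where s: "s \<in> S" "s \<noteq> t" "s \<noteq> d" by blast
  define X where "X = S - {s}"
  have X: "X \<subseteq> {1..t}" "card X = q" "t \<in> X" "d \<in> X" "finite X" "X \<subseteq> S"
    unfolding X_def using S s d(1) finS by auto
  have cX: "card (X - {t}) = q - 1" "card (X - {t, d}) = q - 2"
    using X dt by (simp_all add: card_Diff_subset)
  \<comment> \<open>At \<open>z\<close> the uncolored edge takes the place of the missing color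
    \<open>d\<close>.\<close>
  have deg: "card {a \<in> E. v \<in> a \<and> (a \<in> {e2} \<or> \<chi> a \<in> X - {t})} \<le> q - 1" if v: "v \<noteq> y'" for v
  proof (cases "v = z")
    case True
    have "{a \<in> E. v \<in> a \<and> (a \<in> {e2} \<or> \<chi> a \<in> X - {t})}
        \<subseteq> insert e2 {a \<in> E - {e2}. v \<in> a \<and> \<chi> a \<in> X - {t, d}}"
      using d(2) True by blast
    then have "card {a \<in> E. v \<in> a \<and> (a \<in> {e2} \<or> \<chi> a \<in> X - {t})}
        \<le> card (insert e2 {a \<in> E - {e2}. v \<in> a \<and> \<chi> a \<in> X - {t, d}})"
      using finite_E by (intro card_mono) auto
    also have "\<dots> \<le> Suc (card {a \<in> E - {e2}. v \<in> a \<and> \<chi> a \<in> X - {t, d}})"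
      by (rule card_insert_le_m1) auto
    also have "\<dots> \<le> Suc (q - 2)"
      using proper_on_card_le[OF \<chi>(1), of "X - {t, d}" v] X(5) cX(2) by simp
    finally show ?thesis using q by simp
  next
    case False
    have "v \<notin> e2" using False v unfolding e2_def by blast
    then have "{a \<in> E. v \<in> a \<and> (a \<in> {e2} \<or> \<chi> a \<in> X - {t})}
        = {a \<in> E - {e2}. v \<in> a \<and> \<chi> a \<in> X - {t}}" by blast
    then show ?thesis using proper_on_card_le[OF \<chi>(1), of "X - {t}" v] X(5) cX(1) by simp
  qed
  let ?R = "E - {a \<in> E - {e2}. \<chi> a \<notin> X}"
  \<comment> \<open>At \<open>y'\<close> the color \<open>t\<close> is missing, which makes room for
    \<open>e2\<close>; at any other vertex \<open>t\<close> adds at most one edge to the bound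
    \<open>deg\<close>.\<close>
  have "card {a \<in> ?R. v \<in> a} \<le> q" for v
  proof (cases "v = y'")
    case True
    let ?W = "{a \<in> E - {e2}. v \<in> a \<and> \<chi> a \<in> X - {t}}"
    have "{a \<in> ?R. v \<in> a} \<subseteq> insert e2 ?W"
      using y'M' True \<chi>(3) by blast
    then have "card {a \<in> ?R. v \<in> a} \<le> card (insert e2 ?W)"
      using finite_E by (intro card_mono) auto
    also have "\<dots> \<le> Suc (card ?W)" by (rule card_insert_le_m1) auto
    also have "\<dots> \<le> Suc (q - 1)"
      using proper_on_card_le[OF \<chi>(1), of "X - {t}" v] X(5) cX(1) by simp
    finally show ?thesis using q by simp
  next
    case False
    let ?U = "{a \<in> E. v \<in> a \<and> (a \<in> {e2} \<or> \<chi> a \<in> X - {t})}"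
    let ?W = "{a \<in> E - {e2}. v \<in> a \<and> \<chi> a \<in> {t}}"
    have "{a \<in> ?R. v \<in> a} \<subseteq> ?U \<union> ?W" by blast
    then have "card {a \<in> ?R. v \<in> a} \<le> card (?U \<union> ?W)" using finite_E by (intro card_mono) auto
    also have "\<dots> \<le> card ?U + card ?W" by (rule card_Un_le)
    also have "\<dots> \<le> (q - 1) + 1"
      using deg[OF False] proper_on_card_le[OF \<chi>(1), of "{t}" v] by simp
    finally show ?thesis using q by simp
  qed
  then obtain \<psi> where \<psi>: "proper_on ?R \<psi>" "\<psi> ` ?R \<subseteq> X"
    using class_A_colorable[OF G Diff_subset _ X(2,5)] by blast
  have "{a \<in> E - {e2}. \<chi> a \<notin> X} \<subseteq> E" by blast
  then obtain h0 where h0: "proper_on E h0" "agree_off X (E - {e2}) \<chi> E h0"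
    using recolor[OF \<chi>(1) _ refl \<psi>] by blast
  define h' where "h' = restrict h0 E"
  \<comment> \<open>Both recolorings stay within \<open>S\<close>, so the old and the new associated
    coloring differ only in these \<open>q + 1\<close> colors.\<close>
  have "agree_off S E h E h0"
    using agree_off_trans[OF \<chi>(2) agree_off_mono[OF h0(2) X(6)]] .
  then have h': "proper_coloring G t h'" "n_equivalent G t (q + 1) h' f"
    using agree_off_n_equivalent[OF h(2) _ hE(2) finS _ S(1) h0(1)] S(2) unfolding h'_def by auto
  have "agree_off X (E - {e2}) \<chi> E h'"
    using h0(2) unfolding agree_off_def h'_def by (simp cong: conj_cong)
  then have "agree_off X E h' (E - {e2}) \<chi>" by (rule agree_off_sym)
  then have "hole_state G q t f {e2} M' y'"
    using e2E(1) by (intro hole_stateI[OF _ _ y'M' \<chi>(1,3) X(1-3) deg h'(1) _ h'(2)]) simp_all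
  moreover have "M' = insert e1 M - {e2}" using neq(4) unfolding M'_def by blast
  ultimately show ?thesis unfolding e1_def e2_def by simp
qed

text \<open>The instance \<open>D' = {}\<close> of \<open>hole_advance\<close>. It serves paths of
  even length, whose first edge has to regain the color \<open>t\<close> at the end.\<close>

lemma hole_finish_edge:
  assumes st: "hole_state G q t f D M y" and e1: "e1 \<in> E - D" "y \<in> e1" "e1 \<inter> \<Union>M = {}"
  shows "\<exists>h. proper_coloring G t h \<and> n_equivalent G t (q + 1) h f \<and> color_class G h t = insert e1 M"
proof -
  obtain \<phi> where \<phi>: "proper_on (E - D) \<phi>" "{a \<in> E - D. \<phi> a = t} = M"
    using st unfolding hole_state_def by blast
  have M'dis: "pairwise disjnt (insert e1 M)"
    using color_class_disjoint[OF \<phi>] e1(3) unfolding pairwise_insert disjnt_def by blast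
  have M': "insert e1 M = insert e1 (M - {})" by simp
  obtain \<chi> S h where S: "S \<subseteq> {1..t}" "card S = q + 1" "t \<in> S"
    and h: "proper_coloring G t h" "n_equivalent G t (q + 1) h f"
    and \<chi>: "proper_on (E - {}) \<chi>" "agree_off S E h (E - {}) \<chi>" "{a \<in> E - {}. \<chi> a = t} = insert e1 M"
    by (rule hole_advance[OF st e1(1,2) empty_subsetI M' M'dis])
  have "finite S" using S(1) finite_subset by blast
  moreover have "h ` E \<subseteq> {1..t}" using h(1) unfolding proper_coloring_iff by auto
  ultimately have "proper_coloring G t (restrict \<chi> E) \<and> n_equivalent G t (q + 1) (restrict \<chi> E) f"
    using agree_off_n_equivalent[OF h(2), of S \<chi>] \<chi>(1,2) S(1,2) by simp
  moreover have "color_class G (restrict \<chi> E) t = insert e1 M"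
    using \<chi>(3) unfolding color_class_def by (simp cong: conj_cong)
  ultimately show ?thesis by blast
qed

text \<open>At most \<open>t - 2\<close> colored edges meet \<open>y\<close>, so a color
  \<open>c\<close> other than \<open>t\<close> is missing there. It plays the part that the freed
  color plays in \<open>hole_advance\<close>, and the uncolored edge can be filled without changing
  the class of \<open>t\<close>.\<close>

lemma hole_finish_low_degree:
  assumes st: "hole_state G q t f D M y" and y: "e \<in> D" "y \<in> e" "degree G y < t"
  shows "\<exists>h. proper_coloring G t h \<and> n_equivalent G t (q + 1) h f \<and> color_class G h t = M"
proof -
  obtain \<phi> h X where D: "D \<subseteq> E" "card D \<le> 1" "y \<notin> \<Union>M"
    and \<phi>: "proper_on (E - D) \<phi>" "{a \<in> E - D. \<phi> a = t} = M"
    and X: "X \<subseteq> {1..t}" "card X = q" "t \<in> X"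
    and deg: "\<forall>v. v \<noteq> y \<longrightarrow> card {a \<in> E. v \<in> a \<and> (a \<in> D \<or> \<phi> a \<in> X - {t})} \<le> q - 1"
    and h: "proper_coloring G t h" "agree_off X E h (E - D) \<phi>" "n_equivalent G t (q + 1) h f"
    using st unfolding hole_state_def by (elim conjE exE) (rule that; assumption)
  have finX: "finite X" using X(1) finite_subset by blast
  have finD: "finite D" using D(1) finite_E finite_subset by blast
  have hE: "h ` E \<subseteq> {1..t}" using h(1) unfolding proper_coloring_iff by auto
  let ?Y = "{a \<in> E. y \<in> a}"
  have "card (\<phi> ` (?Y - D)) \<le> card (?Y - D)" using finite_E by (intro card_image_le) simp
  also have "\<dots> \<le> card (?Y - {e})" using finite_E y(1) by (intro card_mono) auto
  also have "\<dots> < card ?Y" using finite_E D(1) y by (intro card_Diff1_less) auto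
  also have "\<dots> \<le> t - 1" using y(3) unfolding degree_def by simp
  also have "\<dots> = card ({1..t} - {t})" using q_less_t by simp
  finally have "\<exists>c \<in> {1..t} - {t}. c \<notin> \<phi> ` (?Y - D)"
    using exists_not_mem_if_card_less[of "\<phi> ` (?Y - D)"] finite_E by simp
  then obtain c where c: "c \<in> {1..t}" "c \<noteq> t" "c \<notin> \<phi> ` (?Y - D)" by blast
  have "\<exists>s \<in> {1..t}. s \<notin> X" using exists_not_mem_if_card_less[OF finX] X(2) q_less_t by simp
  then obtain s where s: "s \<in> {1..t} - X" "c \<in> insert s X" using c(1) by blast
  define S where "S = insert s X"
  have S: "S \<subseteq> {1..t}" "card S = q + 1" "t \<in> S" "X \<subseteq> S" "c \<in> S" "finite S"
    unfolding S_def using s X finX by auto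
  have card_S: "card (S - {t, c}) = q - 1"
    using S(2,3,5,6) c(2) by (simp add: card_Diff_subset)
  have "card {a \<in> E. v \<in> a \<and> (a \<in> E - D \<longrightarrow> \<phi> a \<in> S) \<and> a \<notin> M} \<le> q" for v
  proof -
    let ?Z = "{a \<in> E. v \<in> a \<and> (a \<in> E - D \<longrightarrow> \<phi> a \<in> S) \<and> a \<notin> M}"
    show ?thesis
    proof (cases "v = y")
      case True
      let ?W = "{a \<in> E - D. v \<in> a \<and> \<phi> a \<in> S - {t, c}}"
      have "?Z \<subseteq> D \<union> ?W" using c(3) True \<phi>(2) by blast
      then have "card ?Z \<le> card (D \<union> ?W)" using finD finite_E by (intro card_mono) auto
      also have "\<dots> \<le> card D + card ?W" by (rule card_Un_le)
      also have "\<dots> \<le> 1 + (q - 1)"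
        using D(2) proper_on_card_le[OF \<phi>(1), of "S - {t, c}" v] S(6) card_S by simp
      finally show ?thesis using q by simp
    next
      case False
      let ?U = "{a \<in> E. v \<in> a \<and> (a \<in> D \<or> \<phi> a \<in> X - {t})}"
      let ?W = "{a \<in> E - D. v \<in> a \<and> \<phi> a \<in> {s}}"
      have "?Z \<subseteq> ?U \<union> ?W" using \<phi>(2) unfolding S_def by blast
      then have "card ?Z \<le> card (?U \<union> ?W)" using finite_E by (intro card_mono) auto
      also have "\<dots> \<le> card ?U + card ?W" by (rule card_Un_le)
      also have "\<dots> \<le> (q - 1) + 1"
        using deg[rule_format, OF False] proper_on_card_le[OF \<phi>(1), of "{s}" v] by simp
      finally show ?thesis using q by simp
    qed
  qed
  moreover have "{a \<in> E - D. \<phi> a \<notin> S} \<subseteq> E" by blast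
  moreover have "M \<subseteq> E" using \<phi>(2) by blast
  moreover have "\<phi> a \<in> S" if "a \<in> M" "a \<in> E - D" for a using that \<phi>(2) S(3) by blast
  moreover have "pairwise disjnt M" by (rule color_class_disjoint[OF \<phi>])
  ultimately have "\<exists>\<chi>. proper_on E \<chi> \<and> agree_off S (E - D) \<phi> E \<chi> \<and> {a \<in> E. \<chi> a = t} = M"
    by (intro recolor_with_matching[OF G \<phi>(1) _ _ _ _ _ S(2,3)]) (assumption | rule subset_refl)+
  then obtain \<chi> where \<chi>: "proper_on E \<chi>" "agree_off S (E - D) \<phi> E \<chi>" "{a \<in> E. \<chi> a = t} = M"
    by blast
  have "agree_off S E h E \<chi>" using agree_off_trans[OF agree_off_mono[OF h(2) S(4)] \<chi>(2)] .
  then have "proper_coloring G t (restrict \<chi> E) \<and> n_equivalent G t (q + 1) (restrict \<chi> E) f"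
    using agree_off_n_equivalent[OF h(3) _ hE S(6) _ S(1) \<chi>(1)] S(2) by simp
  moreover have "color_class G (restrict \<chi> E) t = M"
    using \<chi>(3) unfolding color_class_def by (simp cong: conj_cong)
  ultimately show ?thesis by blast
qed

text \<open>Nothing is uncolored, so any \<open>X\<close> works: only \<open>q - 1\<close> of its
  colors differ from \<open>t\<close>. This starts the walk for paths of odd length.\<close>

lemma hole_start_missing:
  assumes "missing_at G f t y"
  shows "hole_state G q t f {} (color_class G f t) y"
proof -
  \<comment> \<open>The color 1 is merely some color other than \<open>t\<close>, as
    \<open>exists_colors_containing\<close> requires.\<close>
  have "1 \<in> {1..t}" "1 \<noteq> t" using q q_less_t by auto
  then obtain X where X: "X \<subseteq> {1..t}" "card X = q" "t \<in> X" using exists_colors_containing by metis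
  have pf: "proper_on E f" using f unfolding proper_coloring_iff by simp
  have finX: "finite X" using X(1) finite_subset by blast
  have "card {a \<in> E. v \<in> a \<and> (a \<in> {} \<or> f a \<in> X - {t})} \<le> q - 1" for v
    using proper_on_card_le[OF pf, of "X - {t}" v] finX X(2,3) by simp
  moreover have "y \<notin> \<Union>(color_class G f t)" using assms unfolding missing_at_def color_class_def by blast
  moreover have "agree_off X E f (E - {}) f" unfolding agree_off_def by simp
  ultimately show ?thesis
    using pf by (intro hole_stateI[OF _ _ _ _ _ X _ f _ n_equivalent_refl[OF f]])
      (simp_all add: color_class_def)
qed

text \<open>The small degree of \<open>u\<close> supplies a color \<open>c\<close> missing there;
  with \<open>c\<close> in \<open>X\<close>, the uncolored edge is compensated at \<open>u\<close>.
  The associated coloring is \<open>f\<close> itself. This starts the walk for paths of even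
  length.\<close>

lemma hole_start_edge:
  assumes e: "{u, y} \<in> color_class G f t" and u: "degree G u < t"
  shows "hole_state G q t f {{u, y}} (color_class G f t - {{u, y}}) y"
proof -
  let ?e = "{u, y}"
  have pf: "proper_on E f" "f ` E \<subseteq> {1..t}" using f unfolding proper_coloring_iff by auto
  have eE: "?e \<in> E" "f ?e = t" using e unfolding color_class_def by auto
  let ?Y = "{a \<in> E. u \<in> a}"
  have "card (f ` ?Y) \<le> card ?Y" using finite_E by (intro card_image_le) simp
  also have "\<dots> < card {1..t}" using u unfolding degree_def by simp
  finally have "\<exists>c \<in> {1..t}. c \<notin> f ` ?Y"
    using exists_not_mem_if_card_less[of "f ` ?Y"] finite_E by simp
  then obtain c where c: "c \<in> {1..t}" "c \<notin> f ` ?Y" by blast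
  have ct: "c \<noteq> t" using c(2) eE by blast
  obtain X where X: "X \<subseteq> {1..t}" "card X = q" "t \<in> X" "c \<in> X"
    using exists_colors_containing[OF c(1) ct] .
  have finX: "finite X" using X(1) finite_subset by blast
  have cX: "card (X - {t}) = q - 1" "card (X - {t, c}) = q - 2"
    using X finX ct by (simp_all add: card_Diff_subset)
  have "card {a \<in> E. v \<in> a \<and> (a \<in> {?e} \<or> f a \<in> X - {t})} \<le> q - 1" if v: "v \<noteq> y" for v
  proof (cases "v = u")
    case True
    have "{a \<in> E. v \<in> a \<and> (a \<in> {?e} \<or> f a \<in> X - {t})} \<subseteq> insert ?e {a \<in> E. v \<in> a \<and> f a \<in> X - {t, c}}"
      using c(2) True by blast
    then have "card {a \<in> E. v \<in> a \<and> (a \<in> {?e} \<or> f a \<in> X - {t})}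
        \<le> card (insert ?e {a \<in> E. v \<in> a \<and> f a \<in> X - {t, c}})"
      using finite_E by (intro card_mono) auto
    also have "\<dots> \<le> Suc (card {a \<in> E. v \<in> a \<and> f a \<in> X - {t, c}})"
      by (rule card_insert_le_m1) auto
    also have "\<dots> \<le> Suc (q - 2)"
      using proper_on_card_le[OF pf(1), of "X - {t, c}" v] finX cX(2) by simp
    finally show ?thesis using q by simp
  next
    case False
    have "{a \<in> E. v \<in> a \<and> (a \<in> {?e} \<or> f a \<in> X - {t})} = {a \<in> E. v \<in> a \<and> f a \<in> X - {t}}"
      using v False by blast
    then show ?thesis using proper_on_card_le[OF pf(1), of "X - {t}" v] finX cX(1) by simp
  qed
  moreover have "y \<notin> \<Union>(color_class G f t - {?e})"
  proof
    assume "y \<in> \<Union>(color_class G f t - {?e})"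
    then obtain a where "a \<in> color_class G f t" "a \<noteq> ?e" "y \<in> a" by auto
    moreover have "pairwise disjnt (color_class G f t)"
      by (rule color_class_disjoint[OF pf(1)]) (simp add: color_class_def)
    ultimately have "disjnt a ?e" using e by (meson pairwiseD)
    then show False using \<open>y \<in> a\<close> by simp
  qed
  moreover have "agree_off X E f (E - {?e}) f" unfolding agree_off_def using eE X(3) by blast
  moreover have "proper_on (E - {?e}) f" using pf(1) unfolding proper_on_def by blast
  moreover have "{a \<in> E - {?e}. f a = t} = color_class G f t - {?e}" unfolding color_class_def by blast
  ultimately show ?thesis
    using eE(1) by (intro hole_stateI[OF _ _ _ _ _ X(1-3) _ f _ n_equivalent_refl[OF f]]) simp_all
qed

section \<open>Walking the hole along the path and around the cycle\<close>

text \<open>Each \<open>hole_step\<close> consumes two edges, one outside \<open>M\<close> and one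
  inside. The edges of the walk are distinct, so earlier steps do not disturb the alternation
  ahead.\<close>

lemma hole_walk:
  assumes st: "hole_state G q t f D M (v 0)" and D: "{v 0, v 1} \<notin> D"
    and inj: "inj_on v {..2 * k}" and k: "1 \<le> k"
    and vE: "\<And>i. i < 2 * k \<Longrightarrow> walk_edge v i \<in> E"
    and alt: "\<And>i. i < 2 * k \<Longrightarrow> walk_edge v i \<in> M \<longleftrightarrow> odd i"
  shows "hole_state G q t f {walk_edge v (2 * k - 1)}
    (sym_diff M (walk_edge v ` {..<2 * k})) (v (2 * k))"
proof -
  have eq: "walk_edge v i = walk_edge v j \<longleftrightarrow> i = j" if "i < 2 * k" "j < 2 * k" for i j
    using walk_edge_eq_iff[OF inj that] .
  \<comment> \<open>Before the first step the uncolored edges are the given \<open>D\<close>,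
    afterwards the edge just passed.\<close>
  have "hole_state G q t f (if j = 0 then D else {walk_edge v (2 * j - 1)})
      (sym_diff M (walk_edge v ` {..<2 * j})) (v (2 * j))" if "j \<le> k" for j
    using that
  proof (induction j)
    case 0
    then show ?case using st by simp
  next
    case (Suc j)
    let ?D = "if j = 0 then D else {walk_edge v (2 * j - 1)}"
    let ?W = "walk_edge v ` {..<2 * j}"
    let ?a = "walk_edge v (2 * j)" and ?b = "walk_edge v (Suc (2 * j))"
    have jk: "2 * j < 2 * k" "Suc (2 * j) < 2 * k" using Suc.prems by auto
    have "?a \<notin> ?D"
    proof (cases "j = 0")
      case True
      then show ?thesis using D by (simp add: walk_edge_def)
    next
      case False
      then have "?a \<noteq> walk_edge v (2 * j - 1)" using eq[of "2 * j" "2 * j - 1"] jk by simp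
      then show ?thesis using False by simp
    qed
    then have a: "{v (2 * j), v (Suc (2 * j))} \<in> E - ?D"
      using vE[OF jk(1)] by (simp add: walk_edge_def)
    have aW: "?a \<notin> ?W" "?b \<notin> ?W" "?a \<noteq> ?b" using eq jk by auto
    have aM: "?a \<notin> M" "?b \<in> M" using alt[OF jk(1)] alt[OF jk(2)] by auto
    have b: "{v (Suc (2 * j)), v (2 * Suc j)} \<in> sym_diff M ?W"
      using aW aM by (simp add: walk_edge_def)
    have "hole_state G q t f {?b} (insert ?a (sym_diff M ?W) - {?b}) (v (2 * Suc j))"
      using hole_step[OF Suc.IH a b] Suc.prems by (simp add: walk_edge_def)
    moreover have "insert ?a (sym_diff M ?W) - {?b} = sym_diff M (insert ?a (insert ?b ?W))"
      using aW aM by blast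
    moreover have "insert ?a (insert ?b ?W) = walk_edge v ` {..<2 * Suc j}"
      by (auto simp: lessThan_Suc)
    ultimately show ?case by simp
  qed
  from this[of k] k show ?thesis by simp
qed

text \<open>Here \<open>Q\<close> lists the vertices of \<open>P\<close> and then those of \<open>C\<close>, which starts at \<open>Q L\<close> and is closed by
  the edge \<open>{Q N, Q L}\<close>.\<close>

lemma flip_cycle:
  assumes inj: "inj_on Q {..N}" and L: "1 \<le> L" "L + 2 \<le> N" "odd (L + N)"
    and QE: "\<And>i. i < N \<Longrightarrow> walk_edge Q i \<in> E"
    and alt: "\<And>i. i < N \<Longrightarrow> walk_edge Q i \<in> color_class G f t \<longleftrightarrow> even (L + i)"
    and close: "{Q N, Q L} \<in> E" "{Q N, Q L} \<notin> color_class G f t"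
    and deg: "degree G (Q 0) < t" and miss: "odd L \<Longrightarrow> missing_at G f t (Q 0)"
  shows "\<exists>h. proper_coloring G t h \<and> n_equivalent G t (q + 1) h f \<and>
    color_class G h t = sym_diff (color_class G f t) (insert {Q N, Q L} (walk_edge Q ` {L..<N}))"
proof -
  define M where "M = color_class G f t"
  note alt = alt[folded M_def] and close = close[folded M_def]
  \<comment> \<open>For even \<open>L\<close> the first edge has color \<open>t\<close>; it is uncolored at the start and the hole is at \<open>Q 1\<close>.\<close>
  define s :: nat where "s = (if even L then 1 else 0)"
  have s: "s \<le> 1" "s < L" "odd (L + s)"
    using L(1) by (auto simp: s_def dest: le_neq_implies_less)
  define D0 where "D0 = (if even L then {walk_edge Q 0} else {})"
  define M0 where "M0 = M - D0"
  let ?e = "{Q N, Q L}"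
  have eq: "walk_edge Q i = walk_edge Q j \<longleftrightarrow> i = j" if "i < N" "j < N" for i j
    using walk_edge_eq_iff[OF inj that] .
  have Qeq: "Q i = Q j \<longleftrightarrow> i = j" if "i \<le> N" "j \<le> N" for i j
    using inj_on_eq_iff[OF inj] that by simp
  \<comment> \<open>The ends of the closing edge have indices at least 2 apart.\<close>
  have e_neq: "walk_edge Q i \<noteq> ?e" if "i < N" for i
  proof
    assume "walk_edge Q i = ?e"
    then have "Q N \<in> {Q i, Q (Suc i)}" "Q L \<in> {Q i, Q (Suc i)}" unfolding walk_edge_def by auto
    then have "N \<in> {i, Suc i}" "L \<in> {i, Suc i}" using Qeq that L(2) by auto
    then show False using that L(2) by auto
  qed
  have pf: "proper_on E f" using f unfolding proper_coloring_iff by simp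
  have Mdis: "pairwise disjnt M"
    unfolding M_def by (rule color_class_disjoint[OF pf]) (simp add: color_class_def)
  have M0: "walk_edge Q i \<in> M0 \<longleftrightarrow> even (L + i)" if "s \<le> i" "i < N" for i
    using alt[of i] eq[of i 0] that unfolding M0_def D0_def s_def by (auto split: if_splits)
  have st0: "hole_state G q t f D0 M0 (Q s)"
  proof (cases "even L")
    case True
    then have "{Q 0, Q 1} \<in> color_class G f t" using alt[of 0] L M_def by (simp add: walk_edge_def)
    then show ?thesis
      using hole_start_edge[OF _ deg] True
      by (simp add: D0_def M0_def s_def M_def walk_edge_def)
  next
    case False
    then show ?thesis
      using hole_start_missing[OF miss] by (simp add: D0_def M0_def s_def M_def)
  qed

  \<comment> \<open>First pass: along \<open>P\<close> and around \<open>C\<close> up to its last vertex \<open>Q N\<close>.\<close>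
  define v where "v i = Q (i + s)" for i
  have v_edge: "walk_edge v i = walk_edge Q (i + s)" for i by (simp add: walk_edge_def v_def)
  \<comment> \<open>The hole moves two edges at a time; by parity it stops exactly at
    \<open>Q N\<close>.\<close>
  have "even (N - s)" using L s by (metis even_add even_diff_nat odd_add)
  then obtain k where k: "N - s = 2 * k" by (rule evenE)
  have k1: "1 \<le> k" "2 * k + s = N" using k L s by auto
  have "hole_state G q t f {walk_edge v (2 * k - 1)}
    (sym_diff M0 (walk_edge v ` {..<2 * k})) (v (2 * k))"
  proof (rule hole_walk)
    show "hole_state G q t f D0 M0 (v 0)" using st0 by (simp add: v_def)
    have "walk_edge Q s \<notin> D0" using eq[of s 0] L s by (auto simp: D0_def s_def split: if_splits)
    then show "{v 0, v 1} \<notin> D0" by (simp add: walk_edge_def v_def)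
    show "inj_on v {..2 * k}"
    proof (rule inj_onI)
      fix x y assume "x \<in> {..2 * k}" "y \<in> {..2 * k}" "v x = v y"
      then show "x = y" using Qeq[of "x + s" "y + s"] k1(2) by (simp add: v_def)
    qed
    show "1 \<le> k" by (rule k1)
  next
    fix i assume i: "i < 2 * k"
    then show "walk_edge v i \<in> E" using QE[of "i + s"] k1(2) v_edge by simp
    have "even (L + (i + s)) \<longleftrightarrow> odd i" using s(3) by presburger
    then show "walk_edge v i \<in> M0 \<longleftrightarrow> odd i" using M0[of "i + s"] k1(2) v_edge i by simp
  qed
  moreover have "walk_edge v ` {..<2 * k} = walk_edge Q ` {s..<N}"
  proof -
    have "walk_edge v ` {..<2 * k} = walk_edge Q ` ((\<lambda>i. i + s) ` {..<2 * k})"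
      unfolding image_image v_edge ..
    also have "(\<lambda>i. i + s) ` {..<2 * k} = {s..<N}"
      using image_add_atLeastLessThan'[of s 0 "2 * k"] k1(2) by (simp add: atLeast0LessThan)
    finally show ?thesis .
  qed
  moreover have "walk_edge v (2 * k - 1) = walk_edge Q (N - 1)" using v_edge k1 by (simp add: algebra_simps)
  moreover have "v (2 * k) = Q N" using k1 by (simp add: v_def)
  ultimately have st1: "hole_state G q t f {walk_edge Q (N - 1)} (sym_diff M0 (walk_edge Q ` {s..<N})) (Q N)"
    by simp

  \<comment> \<open>Second pass: over the closing edge of \<open>C\<close> and back along \<open>P\<close>.\<close>
  define M1 where "M1 = sym_diff M0 (walk_edge Q ` {s..<N})"
  \<comment> \<open>Since \<open>u 1 = Q L\<close>, the closing edge comes first; the indices then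
    descend along the path to \<open>u (2 * m) = Q s\<close>.\<close>
  define u where "u i = (if i = 0 then Q N else Q (Suc L - i))" for i
  have u0: "walk_edge u 0 = ?e" by (simp add: walk_edge_def u_def)
  have u_edge: "walk_edge u i = walk_edge Q (L - i)" if "1 \<le> i" "i \<le> L" for i
    using that by (auto simp: walk_edge_def u_def Suc_diff_le)
  have "even (L + 1 - s)" using s by (metis Suc_eq_plus1 even_Suc even_add even_diff_nat odd_add)
  then obtain m where m: "L + 1 - s = 2 * m" by (rule evenE)
  have m1: "1 \<le> m" "2 * m + s = L + 1" using m s by auto
  have "hole_state G q t f {walk_edge u (2 * m - 1)}
    (sym_diff M1 (walk_edge u ` {..<2 * m})) (u (2 * m))"
  proof (rule hole_walk)
    show "hole_state G q t f {walk_edge Q (N - 1)} M1 (u 0)" using st1 by (simp add: u_def M1_def)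
    show "{u 0, u 1} \<notin> {walk_edge Q (N - 1)}"
      using e_neq[of "N - 1"] L(2) by (auto simp: u_def)
    show "inj_on u {..2 * m}"
    proof (rule inj_onI)
      fix x y assume "x \<in> {..2 * m}" "y \<in> {..2 * m}" "u x = u y"
      then show "x = y" using Qeq m1(2) L(2) by (auto simp: u_def split: if_splits)
    qed
    show "1 \<le> m" by (rule m1)
  next
    fix i assume i: "i < 2 * m"
    show "walk_edge u i \<in> E"
    proof (cases "i = 0")
      case True
      then show ?thesis using close(1) u0 by simp
    next
      case False
      then show ?thesis using u_edge[of i] QE[of "L - i"] i m1(2) L(2) by simp
    qed
    show "walk_edge u i \<in> M1 \<longleftrightarrow> odd i"
    proof (cases "i = 0")
      case True
      have "?e \<notin> walk_edge Q ` {s..<N}" using e_neq by (metis atLeastLessThan_iff imageE)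
      then show ?thesis using True close(2) u0 by (simp add: M1_def M0_def)
    next
      case False
      then have li: "s \<le> L - i" "L - i < N" "1 \<le> i" "i \<le> L" using i m1(2) L(2) by auto
      \<comment> \<open>The first pass toggled the path edges, which gives the reversed path the
        alternation that \<open>hole_walk\<close> demands.\<close>
      then have "walk_edge Q (L - i) \<in> M1 \<longleftrightarrow> odd (L + (L - i))" using M0 by (auto simp: M1_def)
      moreover have "odd (L + (L - i)) \<longleftrightarrow> odd i" using li(4) by presburger
      ultimately show ?thesis using u_edge li by simp
    qed
  qed
  moreover have "walk_edge u ` {..<2 * m} = insert ?e (walk_edge Q ` {s..<L})"
  proof -
    have split: "{..<2 * m} = insert 0 {1..<2 * m}" using m1 by auto
    have "walk_edge u ` {1..<2 * m} = (\<lambda>i. walk_edge Q (L - i)) ` {1..<2 * m}"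
      using u_edge m1(2) by (intro image_cong) auto
    also have "\<dots> = walk_edge Q ` ((\<lambda>i. L - i) ` {1..<2 * m})" by (simp add: image_image)
    also have "(\<lambda>i. L - i) ` {1..<2 * m} = {s..<L}"
    proof (intro equalityI subsetI)
      fix j assume "j \<in> {s..<L}"
      then have "j = L - (L - j)" "L - j \<in> {1..<2 * m}" using m1(2) by auto
      then show "j \<in> (\<lambda>i. L - i) ` {1..<2 * m}" by (rule image_eqI)
    qed (use m1(2) in auto)
    finally show ?thesis unfolding split image_insert u0 by simp
  qed
  moreover have "walk_edge u (2 * m - 1) = walk_edge Q s"
  proof -
    have "2 * m - 1 = L - s" "L - (L - s) = s" using m1(2) s by auto
    then show ?thesis using u_edge[of "L - s"] s by simp
  qed
  moreover have "u (2 * m) = Q s"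
  proof -
    have "Suc L - 2 * m = s" "m \<noteq> 0" using m1 by auto
    then show ?thesis by (simp add: u_def)
  qed
  moreover have "sym_diff M1 (insert ?e (walk_edge Q ` {s..<L}))
      = sym_diff M0 (insert ?e (walk_edge Q ` {L..<N}))"
  proof -
    have "{s..<N} = {s..<L} \<union> {L..<N}" using L s by auto
    then have un: "walk_edge Q ` {s..<N} = walk_edge Q ` {s..<L} \<union> walk_edge Q ` {L..<N}"
      by (simp add: image_Un)
    have "walk_edge Q ` {s..<L} \<inter> walk_edge Q ` {L..<N} = {}" using eq L(2) by fastforce
    moreover have "?e \<notin> walk_edge Q ` {s..<N}" using e_neq by (metis atLeastLessThan_iff imageE)
    ultimately show ?thesis unfolding M1_def un by (rule sym_diff_replace)
  qed
  ultimately have st2: "hole_state G q t f {walk_edge Q s}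
      (sym_diff M0 (insert ?e (walk_edge Q ` {L..<N}))) (Q s)"
    by simp
  let ?C = "insert ?e (walk_edge Q ` {L..<N})"
  show ?thesis
  proof (cases "even L")
    \<comment> \<open>The hole is back at the origin, whose small degree lets the uncolored first
      edge be filled.\<close>
    case False
    then have "s = 0" "M0 = M" by (auto simp: s_def M0_def D0_def)
    then show ?thesis
      using hole_finish_low_degree[OF st2 singletonI _] deg by (simp add: M_def walk_edge_def)
  next
    \<comment> \<open>The hole is at \<open>Q 1\<close>, and the first edge, deprived of
      \<open>t\<close> at the start, is given \<open>t\<close> again. It meets no other edge of that
      class, because \<open>M\<close> is a matching and the cycle avoids \<open>Q 0\<close>.\<close>
    case True
    let ?a = "walk_edge Q 0"
    have s1: "s = 1" "M0 = M - {?a}" using True by (auto simp: s_def M0_def D0_def)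
    have aM: "?a \<in> M" using alt[of 0] True L by simp
    have aC: "?a \<notin> ?C" using e_neq[of 0] eq L(1,2) by force
    have "Q 0 \<noteq> Q j" if "L \<le> j" "j \<le> N" for j using Qeq[of 0 j] L(1) that by simp
    then have Q0C: "Q 0 \<notin> \<Union>?C" using L(2) by (auto simp: walk_edge_def)
    have Q0M: "Q 0 \<notin> \<Union>M0"
    proof
      assume "Q 0 \<in> \<Union>M0"
      then obtain b where b: "b \<in> M" "b \<noteq> ?a" "Q 0 \<in> b" using s1 by auto
      then have "disjnt b ?a" using Mdis aM by (meson pairwiseD)
      then show False using b(3) by (simp add: walk_edge_def)
    qed
    have "Q s \<notin> \<Union>(sym_diff M0 ?C)" using st2 unfolding hole_state_def by simp
    then have "?a \<inter> \<Union>(sym_diff M0 ?C) = {}"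
      using Q0C Q0M s1(1) unfolding walk_edge_def by auto
    moreover have "?a \<in> E - {walk_edge Q s}" using QE[of 0] eq[of 0 1] s1(1) L by simp
    moreover have "Q s \<in> ?a" using s1(1) by (simp add: walk_edge_def)
    ultimately obtain h where h: "proper_coloring G t h" "n_equivalent G t (q + 1) h f"
      "color_class G h t = insert ?a (sym_diff M0 ?C)"
      using hole_finish_edge[OF st2] by meson
    have "insert ?a (sym_diff M0 ?C) = sym_diff M ?C" using aM aC s1(2) by blast
    then show ?thesis using h unfolding M_def by auto
  qed
qed

end

section \<open>Enumerating an alternating cycle from a given vertex\<close>

lemma add_mod_inj:
  fixes a b j n :: nat
  assumes "(j + a) mod n = (j + b) mod n" "a \<le> b" "b < a + n"
  shows "a = b"
proof -
  have "n dvd (j + b) - (j + a)" using assms(1,2) by (metis add_left_mono mod_eq_dvd_iff_nat)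
  then have "n dvd b - a" by simp
  then show ?thesis using assms(2,3) by (cases "b - a = 0") (auto dest: dvd_imp_le)
qed

text \<open>As \<open>n\<close> is at least 3, no edge is repeated in the opposite direction; the
  \<open>n\<close> distinct edges then exhaust \<open>F\<close> by counting.\<close>

lemma cycle_enum_edges:
  assumes c: "inj_on c {..<n}" "c n = c 0" "3 \<le> n"
    and sub: "walk_edge c ` {..<n} \<subseteq> F" and F: "finite F" "card F \<le> n"
  shows "inj_on (walk_edge c) {..<n}" "F = walk_edge c ` {..<n}"
proof -
  have ceq: "c i = c j \<longleftrightarrow> i = j" if "i < n" "j < n" for i j
    using inj_on_eq_iff[OF c(1)] that by simp
  show inj: "inj_on (walk_edge c) {..<n}"
  proof (rule linorder_inj_onI')
    fix i k assume ik: "i \<in> {..<n}" "k \<in> {..<n}" "i < k"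
    show "walk_edge c i \<noteq> walk_edge c k"
    proof
      assume "walk_edge c i = walk_edge c k"
      then consider "c i = c k" | "c i = c (Suc k)" "c (Suc i) = c k"
        unfolding walk_edge_def doubleton_eq_iff by blast
      then show False
      proof cases
        case 1
        then show ?thesis using ceq ik by simp
      next
        case 2
        then have k: "k = Suc i" using ceq[of "Suc i" k] ik by simp
        show ?thesis
        proof (cases "Suc k < n")
          case True
          then show ?thesis using 2(1) ceq[of i "Suc k"] ik by simp
        next
          case False
          then have "Suc k = n" using ik by simp
          then have "i = 0" using 2(1) c(2,3) ceq[of i 0] ik by simp
          then show ?thesis using k \<open>Suc k = n\<close> c(3) by simp
        qed
      qed
    qed
  qed
  have "card (walk_edge c ` {..<n}) = n" using card_image[OF inj] by simp
  then show "F = walk_edge c ` {..<n}" using card_seteq[OF F(1) sub] F(2) by simp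
qed

text \<open>Of the two edges of \<open>C\<close> at \<open>w\<close> exactly one lies in
  \<open>M\<close>, and the direction is chosen to begin with it. Alternation around the closed walk
  makes \<open>n\<close> even.\<close>

lemma alternating_cycle_enum:
  assumes C: "is_cycle C" and w: "w \<in> verts C" and sub: "edges C \<subseteq> sym_diff M N"
    and M: "pairwise disjnt M" and N: "pairwise disjnt N"
  obtains c n where "3 \<le> n" "even n" "inj_on c {..<n}" "c n = c 0" "c 0 = w"
    "c ` {..<n} = verts C" "edges C = walk_edge c ` {..<n}"
    "\<And>i. i < n \<Longrightarrow> walk_edge c i \<in> M \<longleftrightarrow> even i"
proof -
  note result = that
  obtain vs where vs: "length vs \<ge> 3" "distinct vs" "verts C = set vs"
    "edges C = {{vs ! i, vs ! (Suc i mod length vs)} | i. i < length vs}"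
    using C unfolding is_cycle_def by blast
  define n where "n = length vs"
  have n: "3 \<le> n" using vs(1) by (simp add: n_def)
  obtain j where j: "j < n" "vs ! j = w" using w vs(3) by (auto simp: in_set_conv_nth n_def)
  have EC: "edges C = (\<lambda>i. {vs ! i, vs ! (Suc i mod n)}) ` {..<n}" unfolding vs(4) n_def by auto
  have fin: "finite (edges C)" "card (edges C) \<le> n"
    unfolding EC using card_image_le[of "{..<n}"] by auto
  have mem: "{vs ! (k mod n), vs ! (Suc k mod n)} \<in> edges C" for k
  proof -
    have "{vs ! (k mod n), vs ! (Suc (k mod n) mod n)} \<in> edges C" using n unfolding EC by simp
    then show ?thesis by (simp add: mod_Suc_eq)
  qed
  \<comment> \<open>Two edges of \<open>C\<close> sharing a vertex cannot both lie in
    \<open>M\<close> or both in \<open>N\<close>, and every edge of \<open>C\<close> lies in exactly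
    one of these.\<close>
  have swap: "a \<in> M \<longleftrightarrow> b \<notin> M"
    if "a \<in> edges C" "b \<in> edges C" "a \<noteq> b" "x \<in> a" "x \<in> b" for a b x
  proof -
    have "\<not> disjnt a b" using that(4,5) unfolding disjnt_def by blast
    then have "\<not> (a \<in> M \<and> b \<in> M)" "\<not> (a \<in> N \<and> b \<in> N)"
      using M N that(3) unfolding pairwise_def by blast+
    then show ?thesis using sub that(1,2) by blast
  qed
  have vmem: "vs ! (k mod n) \<in> verts C" for k
    unfolding vs(3) using n by (intro nth_mem) (simp add: n_def[symmetric])
  have veq: "vs ! (a mod n) = vs ! (b mod n) \<longleftrightarrow> a mod n = b mod n" for a b
  proof -
    have "a mod n < length vs" "b mod n < length vs" using n by (simp_all add: n_def[symmetric])
    then show ?thesis using nth_eq_iff_index_eq[OF vs(2)] by blast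
  qed
  \<comment> \<open>This part is common to both directions: it assumes only an enumeration starting
    at \<open>w\<close> with an edge of \<open>M\<close>.\<close>
  have goal: thesis
    if c: "inj_on c {..<n}" "c n = c 0" "c 0 = w" "c ` {..<n} \<subseteq> verts C"
      "walk_edge c ` {..<n} \<subseteq> edges C" "walk_edge c 0 \<in> M" for c
  proof -
    have inj: "inj_on (walk_edge c) {..<n}" and E: "edges C = walk_edge c ` {..<n}"
      using cycle_enum_edges[OF c(1,2) n c(5) fin] by auto
    have step: "walk_edge c (Suc i) \<in> M \<longleftrightarrow> walk_edge c i \<notin> M" if "Suc i < n" for i
    proof (rule swap)
      show "walk_edge c (Suc i) \<noteq> walk_edge c i" using inj_on_eq_iff[OF inj] that by simp
    qed (use E that in \<open>auto simp: walk_edge_def\<close>)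
    have alt: "walk_edge c i \<in> M \<longleftrightarrow> even i" if "i < n" for i
      using that by (induction i) (use c(6) step in auto)
    have "walk_edge c (n - 1) \<in> M \<longleftrightarrow> walk_edge c 0 \<notin> M"
    proof (rule swap)
      show "walk_edge c (n - 1) \<noteq> walk_edge c 0" using inj_on_eq_iff[OF inj, of "n - 1" 0] n by simp
      show "c 0 \<in> walk_edge c (n - 1)" using c(2) n by (simp add: walk_edge_def)
    qed (use E n in \<open>auto simp: walk_edge_def\<close>)
    then have "even n" using alt[of "n - 1"] c(6) n by simp
    moreover have "c ` {..<n} = verts C"
    proof (rule card_subset_eq)
      show "card (c ` {..<n}) = card (verts C)"
        using card_image[OF c(1)] distinct_card[OF vs(2)] vs(3) by (simp add: n_def)
    qed (use vs(3) c(4) in auto)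
    ultimately show thesis using result[OF n _ c(1-3) _ E alt] by simp
  qed
  \<comment> \<open>\<open>c\<close> and \<open>c'\<close> run through the cycle in opposite
    directions; \<open>n - i\<close> avoids a negative index.\<close>
  define c where "c i = vs ! ((j + i) mod n)" for i
  define c' where "c' i = vs ! ((j + (n - i)) mod n)" for i
  have injc: "inj_on c {..<n}"
  proof (rule linorder_inj_onI')
    fix x y assume xy: "x \<in> {..<n}" "y \<in> {..<n}" "x < y"
    then have "(j + x) mod n \<noteq> (j + y) mod n" using add_mod_inj[of j x n y] by auto
    then show "c x \<noteq> c y" by (simp add: c_def veq)
  qed
  have injc': "inj_on c' {..<n}"
  proof (rule linorder_inj_onI')
    fix x y assume xy: "x \<in> {..<n}" "y \<in> {..<n}" "x < y"
    then have "n - y \<le> n - x" "n - x < n - y + n" "n - y \<noteq> n - x" by auto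
    then have "(j + (n - y)) mod n \<noteq> (j + (n - x)) mod n"
      using add_mod_inj[of j "n - y" n "n - x"] by blast
    then show "c' x \<noteq> c' y" by (simp add: c'_def veq)
  qed
  have c0: "c n = c 0" "c 0 = w" "c' n = c' 0" "c' 0 = w" using j by (auto simp: c_def c'_def)
  have cV: "c ` {..<n} \<subseteq> verts C" "c' ` {..<n} \<subseteq> verts C" using vmem unfolding c_def c'_def by blast+
  have cE: "walk_edge c ` {..<n} \<subseteq> edges C" using mem by (auto simp: walk_edge_def c_def)
  have cE': "walk_edge c' ` {..<n} \<subseteq> edges C"
  proof
    fix e assume "e \<in> walk_edge c' ` {..<n}"
    then obtain i where i: "i < n" "e = walk_edge c' i" by blast
    define k where "k = j + (n - Suc i)"
    have "j + (n - i) = Suc k" using i(1) by (simp add: k_def)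
    then have "e = {vs ! (Suc k mod n), vs ! (k mod n)}" unfolding i(2) walk_edge_def c'_def k_def by simp
    then show "e \<in> edges C" using mem[of k] by (simp add: insert_commute)
  qed
  show thesis
  proof (cases "walk_edge c 0 \<in> M")
    case True
    then show ?thesis using goal[OF injc c0(1,2) cV(1) cE] by simp
  next
    case False
    have "c 1 \<noteq> c' 1"
    proof -
      have "1 \<le> n - 1" "n - 1 < 1 + n" "1 \<noteq> n - 1" using n by auto
      then have "(j + 1) mod n \<noteq> (j + (n - 1)) mod n" using add_mod_inj[of j 1 n "n - 1"] by blast
      then show ?thesis by (simp add: c_def c'_def veq del: One_nat_def)
    qed
    moreover have "c 1 \<noteq> w" using inj_on_eq_iff[OF injc, of 1 0] n c0 by simp
    ultimately have neq: "walk_edge c 0 \<noteq> walk_edge c' 0"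
      using c0 by (auto simp: walk_edge_def doubleton_eq_iff)
    have "walk_edge c 0 \<in> edges C" "walk_edge c' 0 \<in> edges C" using cE cE' n by auto
    moreover have "w \<in> walk_edge c 0" "w \<in> walk_edge c' 0" using c0 by (auto simp: walk_edge_def)
    ultimately have "walk_edge c' 0 \<in> M" using swap[OF _ _ neq] False by blast
    then show ?thesis using goal[OF injc' c0(3,4) cV(2) cE'] by simp
  qed
qed

section \<open>Joining the path and the cycle into one walk\<close>

theorem lemma3p4:
  fixes q t :: nat
    and G C :: "'a graph"
    and f g :: "'a set \<Rightarrow> nat"
    and P :: "'a list"
  assumes "q \<ge> 3"
    and "G \<in> class_A q"
    and "max_degree G = t"
    and "t \<ge> q + 2"
    and "proper_coloring G t f"
    and "proper_coloring G t g"
    and "f \<noteq> g"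
    and "is_component C (diff_subgraph G f g t)"
    and "is_cycle C"
    and "card (f ` edges C) \<ge> q + 2"
    and "\<forall>v \<in> verts C. degree G v = t"
    and "is_path G P"
    and "alternating_path f t P"
    and "verts C \<inter> set P = {last P}"
    and "degree G (hd P) < t"
    and "odd (path_length P) \<longrightarrow> missing_at G f t (hd P)"
  shows "\<exists>fb. proper_coloring G t fb \<and>
           n_equivalent G t (q + 1) fb f \<and>
           sym_diff (color_class G fb t) (color_class G f t) \<subseteq> edges C \<and>
           card (color_class G fb t \<inter> color_class G g t)
             > card (color_class G f t \<inter> color_class G g t)"
proof -
  interpret edge_colored_graph G q t f
    using assms(1,2,4,5) by unfold_locales auto
  define M where "M = color_class G f t"
  define N where "N = color_class G g t"
  have pf: "proper_on (edges G) f" "proper_on (edges G) g"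
    using assms(5,6) unfolding proper_coloring_iff by auto
  have dis: "pairwise disjnt M" "pairwise disjnt N"
    unfolding M_def N_def
    by (rule color_class_disjoint[OF pf(1)], simp add: color_class_def,
        rule color_class_disjoint[OF pf(2)], simp add: color_class_def)
  have sub: "edges C \<subseteq> sym_diff M N"
    using assms(8) unfolding is_component_def subgraph_def diff_subgraph_def M_def N_def by auto
  have MNE: "M \<subseteq> edges G" "N \<subseteq> edges G" unfolding M_def N_def color_class_def by auto
  have P: "P \<noteq> []" "distinct P" and PE: "\<And>i. Suc i < length P \<Longrightarrow> {P ! i, P ! Suc i} \<in> edges G"
    using assms(12) unfolding is_path_def by auto
  have wC: "last P \<in> verts C" using assms(14) by blast
  obtain c n where n: "3 \<le> n" "even n" and c: "inj_on c {..<n}" "c n = c 0" "c 0 = last P"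
    "c ` {..<n} = verts C" and EC: "edges C = walk_edge c ` {..<n}"
    and calt: "\<And>i. i < n \<Longrightarrow> walk_edge c i \<in> M \<longleftrightarrow> even i"
    using alternating_cycle_enum[OF assms(9) wC sub dis] by metis
  define L where "L = length P - 1"
  have pl: "path_length P = L" "length (path_edges P) = L" and lenP: "length P = Suc L"
    using P(1) by (auto simp: path_length_def path_edges_def L_def)
  have lastP: "last P = P ! L" and hdP: "hd P = P ! 0" using P(1) by (auto simp: last_conv_nth hd_conv_nth L_def)
  have pe: "path_edges P ! i = {P ! i, P ! Suc i}" if "i < L" for i
    using that by (simp add: path_edges_def L_def)
  \<comment> \<open>With no edge, the origin of \<open>P\<close> would be its terminus on
    \<open>C\<close>, which has degree \<open>t\<close>.\<close>
  have L1: "1 \<le> L"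
  proof (rule ccontr)
    assume "\<not> 1 \<le> L"
    then have "hd P = last P" using lastP hdP by (cases L) auto
    then show False using assms(11,15) wC by auto
  qed
  \<comment> \<open>The last index of the joint walk: \<open>P\<close> has \<open>L + 1\<close>
    vertices, and \<open>C\<close> adds \<open>n - 1\<close> since its first vertex is the terminus
    of \<open>P\<close>.\<close>
  define R where "R = L + n - 1"
  define Q where "Q i = (if i \<le> L then P ! i else c (i - L))" for i
  have Qc: "Q (L + i) = c i" for i using c(3) lastP by (cases i) (auto simp: Q_def)
  have QP: "Q i = P ! i" if "i \<le> L" for i using that by (simp add: Q_def)
  have PC: "P ! i \<notin> verts C" if "i < L" for i
  proof
    assume "P ! i \<in> verts C"
    moreover have "P ! i \<in> set P" using that lenP by simp
    ultimately have "P ! i = P ! L" using assms(14) lastP by auto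
    then show False using nth_eq_iff_index_eq[OF P(2)] that lenP by simp
  qed
  have cC: "c i \<in> verts C" if "i < n" for i using c(4) that by blast
  have edge_P: "walk_edge Q i = {P ! i, P ! Suc i}" if "i < L" for i
    using QP that by (simp add: walk_edge_def)
  have edge_c: "walk_edge Q (L + i) = walk_edge c i" for i
    using Qc[of i] Qc[of "Suc i"] by (simp add: walk_edge_def)
  have Qinj: "inj_on Q {..R}"
  proof (rule linorder_inj_onI')
    fix x y assume xy: "x \<in> {..R}" "y \<in> {..R}" "x < y"
    show "Q x \<noteq> Q y"
    proof (cases "y \<le> L")
      case True
      then show ?thesis using xy QP nth_eq_iff_index_eq[OF P(2)] lenP by simp
    next
      case False
      define b where "b = y - L"
      have b: "y = L + b" "b < n" using False xy n by (auto simp: R_def b_def)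
      show ?thesis
      proof (cases "x < L")
        case True
        then show ?thesis using PC[OF True] cC[OF b(2)] QP Qc b(1) by auto
      next
        case False
        then obtain a where a: "x = L + a" by (metis le_iff_add not_le)
        then show ?thesis using Qc b xy inj_on_eq_iff[OF c(1)] by simp
      qed
    qed
  qed
  have edge_E: "walk_edge Q i \<in> edges G" if "i < R" for i
  proof (cases "i < L")
    case True
    then show ?thesis using PE[of i] edge_P lenP by simp
  next
    case False
    then obtain a where a: "i = L + a" by (metis le_iff_add not_le)
    then have "walk_edge Q i \<in> edges C" using edge_c EC that by (simp add: R_def)
    then show ?thesis using sub MNE by blast
  qed
  have share: "\<not> (a \<in> M \<and> b \<in> M)" if "a \<noteq> b" "x \<in> a" "x \<in> b" for a b x
    using dis(1) that unfolding pairwise_def disjnt_def by blast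
  \<comment> \<open>The parity is fixed backwards from the terminus: the last edge of
    \<open>P\<close> meets \<open>walk_edge c 0\<close>, which has color \<open>t\<close>, so it
    does not have this color itself.\<close>
  have altP: "walk_edge Q i \<in> M \<longleftrightarrow> even (L + i)" if "i < L" for i
  proof -
    have "walk_edge Q (L - Suc k) \<in> M \<longleftrightarrow> odd k" if "k < L" for k
      using that
    proof (induction k)
      case 0
      let ?a = "walk_edge Q (L - 1)"
      have a: "?a = {P ! (L - 1), P ! L}" using edge_P[of "L - 1"] L1 by simp
      have "P ! (L - 1) \<notin> walk_edge c 0"
        using PC[of "L - 1"] cC[of 0] cC[of 1] L1 n by (auto simp: walk_edge_def)
      then have "?a \<noteq> walk_edge c 0" using a by auto
      moreover have "P ! L \<in> ?a" "P ! L \<in> walk_edge c 0" using a c(3) lastP by (auto simp: walk_edge_def)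
      ultimately have "\<not> (?a \<in> M \<and> walk_edge c 0 \<in> M)" by (rule share)
      then show ?case using calt[of 0] n by simp
    next
      case (Suc k)
      define i where "i = L - Suc (Suc k)"
      have i: "L - Suc k = Suc i" "Suc i < L" using Suc.prems by (auto simp: i_def)
      have "f (path_edges P ! i) = t \<or> f (path_edges P ! Suc i) = t"
        using assms(13) i(2) pl(2) unfolding alternating_path_def by simp
      then have "walk_edge Q i \<in> M \<or> walk_edge Q (Suc i) \<in> M"
        using pe[of i] pe[of "Suc i"] edge_P[of i] edge_P[of "Suc i"] i(2)
          edge_E[of i] edge_E[of "Suc i"] n unfolding M_def color_class_def by (auto simp: R_def)
      moreover have "\<not> (walk_edge Q i \<in> M \<and> walk_edge Q (Suc i) \<in> M)"
      proof (rule share[where x = "Q (Suc i)"])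
        show "walk_edge Q i \<noteq> walk_edge Q (Suc i)"
          using walk_edge_eq_iff[OF Qinj, of i "Suc i"] i(2) n by (simp add: R_def)
      qed (auto simp: walk_edge_def)
      ultimately show ?case using Suc.IH Suc.prems i(1) unfolding i_def by auto
    qed
    from this[of "L - Suc i"] have "walk_edge Q i \<in> M \<longleftrightarrow> odd (L - Suc i)" using that by simp
    also have "\<dots> \<longleftrightarrow> even (L + i)" using that by presburger
    finally show ?thesis .
  qed
  have alt: "walk_edge Q i \<in> color_class G f t \<longleftrightarrow> even (L + i)" if "i < R" for i
  proof (cases "i < L")
    case True
    then show ?thesis using altP unfolding M_def by simp
  next
    case False
    then obtain a where a: "i = L + a" by (metis le_iff_add not_le)
    then have "a < n" using that by (simp add: R_def)
    moreover have "even (L + i) \<longleftrightarrow> even a" using a by auto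
    ultimately show ?thesis using edge_c calt[of a] a unfolding M_def by simp
  qed
  have QR: "Q R = c (n - 1)" "Q L = c n" using Qc[of "n - 1"] Qc[of 0] c(2) n by (simp_all add: R_def)
  then have close: "{Q R, Q L} = walk_edge c (n - 1)" using n by (simp add: walk_edge_def)
  have "{Q R, Q L} \<in> edges C" unfolding close EC using n by simp
  then have close': "{Q R, Q L} \<in> edges G" using sub MNE by blast
  have close'': "{Q R, Q L} \<notin> color_class G f t"
    using calt[of "n - 1"] n unfolding M_def close by simp
  have "odd (L + R)" using n L1 unfolding R_def by (auto simp: even_diff_nat)
  moreover have "L + 2 \<le> R" using n by (simp add: R_def)
  moreover have "degree G (Q 0) < t" using assms(15) hdP QP[of 0] by simp
  moreover have "missing_at G f t (Q 0)" if "odd L" using assms(16) pl(1) that hdP QP[of 0] by simp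
  ultimately obtain h where h: "proper_coloring G t h" "n_equivalent G t (q + 1) h f"
    "color_class G h t = sym_diff (color_class G f t) (insert {Q R, Q L} (walk_edge Q ` {L..<R}))"
    using flip_cycle[OF Qinj L1 _ _ edge_E alt close' close''] by blast
  have "walk_edge Q ` {L..<R} = walk_edge c ` {..<n - 1}"
  proof -
    have "{L..<R} = (\<lambda>i. L + i) ` {..<n - 1}"
      using image_add_atLeastLessThan[of L 0 "n - 1"] n by (simp add: R_def atLeast0LessThan add.commute)
    then show ?thesis by (simp add: image_image edge_c)
  qed
  moreover have "{..<n} = insert (n - 1) {..<n - 1}" using n by auto
  ultimately have "insert {Q R, Q L} (walk_edge Q ` {L..<R}) = edges C"
    unfolding EC close by simp
  then have hC: "color_class G h t = sym_diff M (edges C)" using h(3) M_def by simp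
  \<comment> \<open>The edges of \<open>C\<close> in \<open>M\<close> are outside \<open>N\<close>
    and its other edges are in \<open>N\<close>. Flipping \<open>C\<close> thus loses no common edge
    and gains, for instance, \<open>walk_edge c 1\<close>.\<close>
  have "M \<inter> N \<subset> sym_diff M (edges C) \<inter> N"
  proof -
    have "walk_edge c 1 \<in> edges C" "walk_edge c 1 \<notin> M" using EC calt[of 1] n by auto
    then show ?thesis using sub by blast
  qed
  moreover have "finite (sym_diff M (edges C) \<inter> N)" using MNE finite_E finite_subset by blast
  ultimately have "card (M \<inter> N) < card (color_class G h t \<inter> N)"
    unfolding hC by (intro psubset_card_mono)
  moreover have "sym_diff (color_class G h t) (color_class G f t) \<subseteq> edges C"
    unfolding hC M_def by blast
  ultimately show ?thesis using h(1,2) unfolding M_def N_def by blast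
qed

end
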